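(* Let $1\le p,q\le\infty$, $\max(1/p,1/2)\le s<r$, $A>0$, and put $s'=s+1/2-1/p$. Let the design density $g$ satisfy Assumption A, with $\alpha>0$ if $b=0$, and with $\alpha\in\mathbb{R}$ and $\beta>0$ if $b>0$. Then there is a constant $C>0$, independent of $n$, such that, as $n\to\infty$ (i.e. for all sufficiently large $n$), $$ R_n(B_{p,q}^s(A))\ \ge\ \begin{cases} C\,n^{-\frac{2s}{2s+1}} & \text{if } b=0,\ \alpha s<s',\\[2pt] C\,n^{-\frac{2s'}{2s'+\alpha}} & \text{if } b=0,\ \alpha s\ge s',\\[2pt] C\,(\ln n)^{-\frac{2s'}{\beta}} & \text{if } b>0,\end{cases} $$ where $R_n(B_{p,q}^s(A))=\inf_{\tilde f_n}\sup_{f\in B_{p,q}^s(A)}\mathbb{E}\|\tilde f_n-f\|^2$ is the minimax $L^2$-risk.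
   Context: **Model.** One observes $(x_i,y_i)$, $i=1,\dots,n$, with $y_i=f(x_i)+\xi_i$, where $x_1,\dots,x_n\in[0,1]$ are i.i.d. random variables with known density $g$, $\xi_1,\dots,\xi_n$ are i.i.d. standard Gaussian and independent of the $x_i$, and $f\in L^2([0,1])$ is unknown. $\|\cdot\|$ denotes the $L^2([0,1])$-norm. The infimum in $R_n$ is over all square-integrable estimators $\tilde f_n$ (measurable functions of the observations). **Assumption A.** $g$ is continuous on $[0,1]$, has exactly one zero $x_0\in[0,1]$, and there are constants $\alpha\in\mathbb{R}$, $b\ge0$ ($\alpha>0$ if $b=0$), $\beta>0$, $C_g>0$ such that $\lim_{x\to0} g(x_0+x)\,|x|^{-\alpha}\exp(b|x|^{-\beta})=C_g$ (the limit over $x$ with $x_0+x\in[0,1]$). **Wavelets.** $\varphi^*,\psi^*$ are a compactly supported scaling function and mother wavelet from an $r$-regular multiresolution analysis of $L^2(\mathbb{R})$, generating an orthonormal wavelet basis, with $\mathrm{supp}\,\varphi^*=[L_\varphi,U_\varphi]$, $\mathrm{supp}\,\psi^*=[L_\psi,U_\psi]$, integer endpoints, $L_\varphi\le0\le U_\varphi$, $U_\varphi-L_\varphi\ge4$. The periodized functions on $[0,1]$ are $\varphi_{jk}(x)=\sum_{i\in\mathbb{Z}}2^{j/2}\varphi^*(2^j(x+i)-k)$, $\psi_{jk}(x)=\sum_{i\in\mathbb{Z}}2^{j/2}\psi^*(2^j(x+i)-k)$, $0\le k\le2^j-1$. Let $m_1$ be the smallest integer with $2^{m_1}>\max(U_\varphi-L_\varphi,U_\psi-L_\psi)$.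 For $m\ge m_1$, $\{\varphi_{mk}\}_k\cup\{\psi_{jk}\}_{j\ge m,k}$ is an orthonormal basis of $L^2([0,1])$. Write $a_{mk}=\int_0^1f\varphi_{mk}$, $b_{jk}=\int_0^1f\psi_{jk}$. **Besov ball** (with $s'=s+1/2-1/p$ and $m=m_1$): $$B_{p,q}^s(A)=\Big\{f\in L^p([0,1]):\Big(\sum_{k=0}^{2^m-1}|a_{mk}|^p\Big)^{1/p}+\Big(\sum_{j=m}^\infty2^{js'q}\Big(\sum_{k=0}^{2^j-1}|b_{jk}|^p\Big)^{q/p}\Big)^{1/q}\le A\Big\},$$ with sums replaced by maxima (suprema) if $p=\infty$ and/or $q=\infty$. *)

theory Defs
  imports "HOL-Probability.Probability"
begin

text \<open>
  Elements of \<open>L\<^sup>2\<close> are represented by Borel functions, not by equivalence classes; two functions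
  that agree almost everywhere are at \<open>L2_norm\<close>-distance 0.
\<close>

definition L2 :: "real measure \<Rightarrow> (real \<Rightarrow> real) set" where
  "L2 M = {f \<in> borel_measurable M. integrable M (\<lambda>x. (f x)\<^sup>2)}"

definition L2_inner :: "real measure \<Rightarrow> (real \<Rightarrow> real) \<Rightarrow> (real \<Rightarrow> real) \<Rightarrow> real" where
  "L2_inner M f g = (LINT x|M. f x * g x)"

definition L2_norm :: "real measure \<Rightarrow> (real \<Rightarrow> real) \<Rightarrow> real" where
  "L2_norm M f = sqrt (L2_inner M f f)"

definition L2_closed_subspace :: "real measure \<Rightarrow> (real \<Rightarrow> real) set \<Rightarrow> bool" where
  "L2_closed_subspace M W \<longleftrightarrow>
     W \<subseteq> L2 M \<and> (\<lambda>x. 0) \<in> W \<and>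
     (\<forall>f\<in>W. \<forall>g\<in>W. (\<lambda>x. f x + g x) \<in> W) \<and>
     (\<forall>f\<in>W. \<forall>c. (\<lambda>x. c * f x) \<in> W) \<and>
     (\<forall>u f. (\<forall>n::nat. u n \<in> W) \<longrightarrow> f \<in> L2 M \<longrightarrow>
        (\<lambda>n. L2_norm M (\<lambda>x. u n x - f x)) \<longlonglongrightarrow> 0 \<longrightarrow> f \<in> W)"

definition L2_orthonormal_basis ::
    "real measure \<Rightarrow> (real \<Rightarrow> real) set \<Rightarrow> ('i \<Rightarrow> real \<Rightarrow> real) \<Rightarrow> bool" where
  "L2_orthonormal_basis M W e \<longleftrightarrow>
     (\<forall>i. e i \<in> W) \<and>
     (\<forall>i j. L2_inner M (e i) (e j) = (if i = j then 1 else 0)) \<and>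
     (\<forall>f\<in>W. \<forall>\<epsilon>>0. \<exists>F c. finite F \<and> L2_norm M (\<lambda>x. f x - (\<Sum>i\<in>F. c i * e i x)) < \<epsilon>)"

definition multiresolution_analysis :: "(int \<Rightarrow> (real \<Rightarrow> real) set) \<Rightarrow> (real \<Rightarrow> real) \<Rightarrow> bool" where
  "multiresolution_analysis V \<phi> \<longleftrightarrow>
     (\<forall>j. L2_closed_subspace lborel (V j)) \<and>
     (\<forall>j. V j \<subseteq> V (j + 1)) \<and>
     (\<forall>f. (\<forall>j. f \<in> V j) \<longrightarrow> (AE x in lborel. f x = 0)) \<and>
     (\<forall>f\<in>L2 lborel. \<forall>\<epsilon>>0. \<exists>j. \<exists>h\<in>V j. L2_norm lborel (\<lambda>x. f x - h x) < \<epsilon>) \<and>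
     (\<forall>j f. f \<in> V j \<longleftrightarrow> (\<lambda>x. f (2 * x)) \<in> V (j + 1)) \<and>
     (\<forall>f\<in>V 0. \<forall>k::int. (\<lambda>x. f (x - of_int k)) \<in> V 0) \<and>
     L2_orthonormal_basis lborel (V 0) (\<lambda>(k::int) x. \<phi> (x - of_int k))"

text \<open>
  Meyer's \<open>r\<close>-regularity: all derivatives up to order \<open>r\<close> decay rapidly. \<open>D i\<close> is the \<open>i\<close>-th
  derivative. As in Meyer's definition the derivative of order \<open>r\<close> is understood in the
  weak sense and need not be continuous; functions of class \<open>C\<^sup>r\<close> with rapidly decaying derivatives
  are included.
\<close>

definition r_regular :: "nat \<Rightarrow> (real \<Rightarrow> real) \<Rightarrow> bool" where
  "r_regular r h \<longleftrightarrow>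
     (\<exists>D::nat \<Rightarrow> real \<Rightarrow> real. D 0 = h \<and>
        (\<forall>i<r. \<forall>a b. a \<le> b \<longrightarrow> set_integrable lborel {a..b} (D (Suc i)) \<and>
           (LBINT x:{a..b}. D (Suc i) x) = D i b - D i a) \<and>
        (\<forall>i\<le>r. \<forall>N::nat. \<exists>C. \<forall>x. \<bar>D i x\<bar> \<le> C / (1 + \<bar>x\<bar>) ^ N))"

definition dilate_shift :: "(real \<Rightarrow> real) \<Rightarrow> int \<Rightarrow> int \<Rightarrow> real \<Rightarrow> real" where
  "dilate_shift h j k x = 2 powr (of_int j / 2) * h (2 powr of_int j * x - of_int k)"

text \<open>
  In an \<open>r\<close>-regular analysis \<open>\<phi>\<close> and a compactly supported \<open>\<psi>\<close> are automatically \<open>r\<close>-regular up to a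
  null set; requiring it of the functions themselves selects their regular representatives.
\<close>

definition regular_wavelet_pair :: "nat \<Rightarrow> (real \<Rightarrow> real) \<Rightarrow> (real \<Rightarrow> real) \<Rightarrow> bool" where
  "regular_wavelet_pair r \<phi> \<psi> \<longleftrightarrow>
     (\<exists>V. multiresolution_analysis V \<phi> \<and> r_regular r \<phi> \<and> r_regular r \<psi> \<and>
        L2_orthonormal_basis lborel {f \<in> V 1. \<forall>h\<in>V 0. L2_inner lborel f h = 0}
          (\<lambda>(k::int) x. \<psi> (x - of_int k)) \<and>
        L2_orthonormal_basis lborel (L2 lborel) (\<lambda>(j, k). dilate_shift \<psi> j k))"

definition supp :: "(real \<Rightarrow> real) \<Rightarrow> real set" where
  "supp h = closure {x. h x \<noteq> 0}"

definition periodized :: "(real \<Rightarrow> real) \<Rightarrow> nat \<Rightarrow> nat \<Rightarrow> real \<Rightarrow> real" where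
  "periodized h j k x =
     (\<Sum>\<^sub>\<infinity>i::int. 2 powr (real j / 2) * h (2 ^ j * (x + of_int i) - real k))"

definition coarsest_level :: "int \<Rightarrow> int \<Rightarrow> int \<Rightarrow> int \<Rightarrow> nat" where
  "coarsest_level L\<^sub>\<phi> U\<^sub>\<phi> L\<^sub>\<psi> U\<^sub>\<psi> = (LEAST m. 2 ^ m > max (U\<^sub>\<phi> - L\<^sub>\<phi>) (U\<^sub>\<psi> - L\<^sub>\<psi>))"

definition unit_lborel :: "real measure" where
  "unit_lborel = restrict_space lborel {0..1}"

definition Lp_unit :: "ennreal \<Rightarrow> (real \<Rightarrow> real) set" where
  "Lp_unit p = {f \<in> borel_measurable unit_lborel.
     if p = \<infinity> then \<exists>c. AE x in unit_lborel. \<bar>f x\<bar> \<le> c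
     else integrable unit_lborel (\<lambda>x. \<bar>f x\<bar> powr enn2real p)}"

definition ennreal_powr :: "ennreal \<Rightarrow> real \<Rightarrow> ennreal" where
  "ennreal_powr x a = (if x = \<infinity> then \<infinity> else ennreal (enn2real x powr a))"

definition lp_norm :: "ennreal \<Rightarrow> 'i set \<Rightarrow> ('i \<Rightarrow> ennreal) \<Rightarrow> ennreal" where
  "lp_norm p I a =
     (if p = \<infinity> then (SUP i\<in>I. a i)
      else ennreal_powr (\<Sum>\<^sub>\<infinity>i\<in>I. ennreal_powr (a i) (enn2real p)) (1 / enn2real p))"

text \<open>
  Since \<open>1 / \<infinity> = 0\<close> in \<^typ>\<open>ennreal\<close>, this is \<open>s + 1/2\<close> for \<open>p = \<infinity>\<close>.
\<close>

definition s_prime :: "real \<Rightarrow> ennreal \<Rightarrow> real" where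
  "s_prime s p = s + 1/2 - enn2real (1 / p)"

text \<open>
  The factor \<open>2 powr (j * s')\<close> stands inside the outer norm, whose \<open>q\<close>-th power turns the
  \<open>j\<close>-th term into \<open>2 powr (j * s' * q)\<close> times the \<open>q/p\<close>-th power of the inner sum.
\<close>

definition besov_ball ::
    "(real \<Rightarrow> real) \<Rightarrow> (real \<Rightarrow> real) \<Rightarrow> nat \<Rightarrow> real \<Rightarrow> ennreal \<Rightarrow> ennreal \<Rightarrow> real \<Rightarrow> (real \<Rightarrow> real) set" where
  "besov_ball \<phi> \<psi> m s p q A =
     {f \<in> Lp_unit p.
        lp_norm p {..<2 ^ m} (\<lambda>k. ennreal \<bar>L2_inner unit_lborel f (periodized \<phi> m k)\<bar>) +
        lp_norm q {m..} (\<lambda>j. ennreal (2 powr (real j * s_prime s p)) *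
          lp_norm p {..<2 ^ j} (\<lambda>k. ennreal \<bar>L2_inner unit_lborel f (periodized \<psi> j k)\<bar>))
        \<le> ennreal A}"

definition assumption_A :: "(real \<Rightarrow> real) \<Rightarrow> real \<Rightarrow> real \<Rightarrow> real \<Rightarrow> real \<Rightarrow> real \<Rightarrow> bool" where
  "assumption_A g x\<^sub>0 \<alpha> b \<beta> C\<^sub>g \<longleftrightarrow>
     continuous_on {0..1} g \<and>
     x\<^sub>0 \<in> {0..1} \<and> (\<forall>x\<in>{0..1}. g x = 0 \<longleftrightarrow> x = x\<^sub>0) \<and>
     b \<ge> 0 \<and> (b = 0 \<longrightarrow> \<alpha> > 0) \<and> \<beta> > 0 \<and> C\<^sub>g > 0 \<and>
     ((\<lambda>x. g (x\<^sub>0 + x) * \<bar>x\<bar> powr (- \<alpha>) * exp (b * \<bar>x\<bar> powr (- \<beta>))) \<longlongrightarrow> C\<^sub>g)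
       (at 0 within {x. x\<^sub>0 + x \<in> {0..1}})"

definition probability_density_on_unit :: "(real \<Rightarrow> real) \<Rightarrow> bool" where
  "probability_density_on_unit g \<longleftrightarrow>
     (\<forall>x\<in>{0..1}. g x \<ge> 0) \<and> g \<in> borel_measurable unit_lborel \<and>
     (\<integral>\<^sup>+x. ennreal (g x) \<partial>unit_lborel) = 1"

text \<open>
  A point \<open>\<omega>\<close> of the sample space lists the pairs \<open>(x\<^sub>i, \<xi>\<^sub>i)\<close>, \<open>i = 1, \<dots>, n\<close>. The product measure
  makes all coordinates independent.
\<close>

definition sample_space :: "(real \<Rightarrow> real) \<Rightarrow> nat \<Rightarrow> (nat \<Rightarrow> real \<times> real) measure" where
  "sample_space g n =
     (\<Pi>\<^sub>M i\<in>{1..n}. density unit_lborel (\<lambda>x. ennreal (g x)) \<Otimes>\<^sub>M density lborel (\<lambda>x. ennreal (std_normal_density x)))"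

definition observations ::
    "nat \<Rightarrow> (real \<Rightarrow> real) \<Rightarrow> (nat \<Rightarrow> real \<times> real) \<Rightarrow> (nat \<Rightarrow> real \<times> real)" where
  "observations n f \<omega> = (\<lambda>i\<in>{1..n}. case \<omega> i of (x, \<xi>) \<Rightarrow> (x, f x + \<xi>))"

definition observation_space :: "nat \<Rightarrow> (nat \<Rightarrow> real \<times> real) measure" where
  "observation_space n = (\<Pi>\<^sub>M i\<in>{1..n}. borel)"

definition estimators :: "nat \<Rightarrow> ((nat \<Rightarrow> real \<times> real) \<Rightarrow> real \<Rightarrow> real) set" where
  "estimators n =
     {T. (\<lambda>(d, t). T d t) \<in> borel_measurable (observation_space n \<Otimes>\<^sub>M unit_lborel) \<and>
         (\<forall>d\<in>space (observation_space n). T d \<in> L2 unit_lborel)}"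

definition risk ::
    "(real \<Rightarrow> real) \<Rightarrow> nat \<Rightarrow> ((nat \<Rightarrow> real \<times> real) \<Rightarrow> real \<Rightarrow> real) \<Rightarrow> (real \<Rightarrow> real) \<Rightarrow> ennreal" where
  "risk g n T f =
     (\<integral>\<^sup>+\<omega>. (\<integral>\<^sup>+t. ennreal ((T (observations n f \<omega>) t - f t)\<^sup>2) \<partial>unit_lborel) \<partial>sample_space g n)"

definition minimax_risk :: "(real \<Rightarrow> real) \<Rightarrow> nat \<Rightarrow> (real \<Rightarrow> real) set \<Rightarrow> ennreal" where
  "minimax_risk g n \<F> = (INF T\<in>estimators n. SUP f\<in>\<F>. risk g n T f)"

end

theory Submission
  imports Defs "HOL-Real_Asymp.Real_Asymp"
begin

text \<open>
  All three rates come from perturbations \<open>\<Sum>k\<in>S. c \<psi>\<^sub>j\<^sub>k\<close>, \<open>S \<subseteq> K\<close>, at a single level \<open>j\<close>. Adding one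
  \<open>c \<psi>\<^sub>j\<^sub>k\<close> cannot be detected as long as \<open>n c\<^sup>2 \<integral> \<psi>\<^sub>j\<^sub>k\<^sup>2 g\<close> stays bounded, so averaging over \<open>S\<close>
  (Assouad) gives a risk of order \<open>card K * c\<^sup>2\<close>. The regular rate uses all \<open>2\<^sup>j\<close> wavelets,
  \<open>c\<close> of order \<open>2 powr (- j (s + 1/2))\<close> and \<open>2\<^sup>j\<close> of order \<open>n powr (1 / (2 s + 1))\<close>. The other two use a
  single wavelet supported next to the zero \<open>x\<^sub>0\<close> of \<open>g\<close>, with \<open>c\<close> of order \<open>2 powr (- j s')\<close>: there
  \<open>g\<close> is as small as \<open>2 powr (- j \<alpha>)\<close>, respectively \<open>exp (- \<kappa> 2 powr (j \<beta>))\<close>, so \<open>2\<^sup>j\<close> may be of order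
  \<open>n powr (1 / (2 s' + \<alpha>))\<close>, respectively \<open>(ln n) powr (1 / \<beta>)\<close>.
\<close>

section \<open>Change of measure in the regression model\<close>

text \<open>Given the design, the data are Gaussian, so the second moment of the likelihood ratio
  for adding \<open>h\<close> is explicit: it is the \<open>n\<close>-th power of the integral of
  \<open>g * exp (h\<^sup>2)\<close>. It factorizes over the sample without loss. To use the
  orthonormality of the wavelets the exponential has to be linearized, which needs c^2 \<psi>_jk^2
  \<le> 1, that is, c^2 2^j bounded. For the single wavelet, with c^2 of order 2 powr (-2 j s'),
  this is the inequality s' \<ge> 1/2, equivalently s \<ge> 1/p.

  A second obstacle: the zero of \<open>g\<close> may lie at or near an endpoint of [0,1], where
  periodized wavelets wrap around and meet regions in which \<open>g\<close> is not small. The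
  wavelet is therefore moved inwards by a bounded number of dyadic cells. The displacement is of
  order 2^-j, the size of the support, so only constants change.

  For b = 0 the exponents 2s/(2s+1) and 2s'/(2s'+\<alpha>) agree exactly when \<alpha> s = s'. The
  smaller exponent is the stronger bound, hence the split of the statement at that line.\<close>

definition gauss :: "real measure" where
  "gauss = density lborel (\<lambda>x. ennreal (std_normal_density x))"

definition sample_law :: "(real \<Rightarrow> real) \<Rightarrow> (real \<times> real) measure" where
  "sample_law g = density unit_lborel (\<lambda>x. ennreal (g x)) \<Otimes>\<^sub>M gauss"

lemma sets_gauss [measurable_cong, simp]: "sets gauss = sets borel"
  by (simp add: gauss_def)

lemma space_unit_lborel [simp]: "space unit_lborel = {0..1}"
  by (simp add: unit_lborel_def space_restrict_space)

lemma borel_measurable_unit_lborel: "f \<in> borel_measurable borel \<Longrightarrow> f \<in> borel_measurable unit_lborel"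
  by (simp add: unit_lborel_def measurable_restrict_space1)

lemma prob_space_gauss: "prob_space gauss"
  unfolding gauss_def by (rule prob_space_normal_density) simp

text \<open>Substituting \<open>c + \<xi>\<close> for \<open>\<xi>\<close> on the right and
  completing the square (\<open>eq\<close>) turns the normal density times the exponential tilt back
  into the normal density. This is the one-dimensional Cameron-Martin formula.\<close>

lemma gauss_shift:
  fixes F :: "real \<Rightarrow> ennreal"
  assumes [measurable]: "F \<in> borel_measurable borel"
  shows "(\<integral>\<^sup>+\<xi>. F (\<xi> + c) \<partial>gauss) = (\<integral>\<^sup>+\<xi>. F \<xi> * ennreal (exp (c * \<xi> - c\<^sup>2 / 2)) \<partial>gauss)"
proof -
  have eq: "std_normal_density (c + \<xi>) * exp (c * (c + \<xi>) - c\<^sup>2 / 2) = std_normal_density \<xi>" for \<xi>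
    unfolding std_normal_density_def
    by (simp add: mult.assoc flip: exp_add) (simp add: power2_eq_square field_simps)
  have "(\<integral>\<^sup>+\<xi>. F \<xi> * ennreal (exp (c * \<xi> - c\<^sup>2 / 2)) \<partial>gauss) =
      (\<integral>\<^sup>+\<xi>. F \<xi> * ennreal (std_normal_density \<xi> * exp (c * \<xi> - c\<^sup>2 / 2)) \<partial>lborel)"
    unfolding gauss_def by (subst nn_integral_density) (auto simp: ennreal_mult' mult_ac)
  also have "\<dots> = (\<integral>\<^sup>+\<xi>. F (c + \<xi>) * ennreal (std_normal_density \<xi>) \<partial>lborel)"
    by (subst nn_integral_real_affine[where c=1 and t=c]) (auto simp: eq)
  also have "\<dots> = (\<integral>\<^sup>+\<xi>. F (\<xi> + c) \<partial>gauss)"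
    unfolding gauss_def by (subst nn_integral_density) (auto simp: mult_ac add_ac)
  finally show ?thesis ..
qed

lemma gauss_exp_moment: "(\<integral>\<^sup>+\<xi>. ennreal (exp (c * \<xi>)) \<partial>gauss) = ennreal (exp (c\<^sup>2 / 2))"
proof -
  interpret prob_space gauss by (rule prob_space_gauss)
  have "(\<integral>\<^sup>+\<xi>. ennreal (exp (c * \<xi>)) \<partial>gauss)
      = (\<integral>\<^sup>+\<xi>. ennreal (exp (c\<^sup>2 / 2)) * ennreal (exp (c * \<xi> - c\<^sup>2 / 2)) \<partial>gauss)"
    by (simp flip: ennreal_mult' exp_add)
  \<comment> \<open>\<open>gauss_shift\<close> for F = 1: the tilt has total mass one.\<close>
  also have "\<dots> = (\<integral>\<^sup>+\<xi>. ennreal (exp (c\<^sup>2 / 2)) \<partial>gauss)"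
    by (subst gauss_shift[symmetric]) auto
  finally show ?thesis by (simp add: emeasure_space_1)
qed

lemma prob_space_design:
  assumes "probability_density_on_unit g"
  shows "prob_space (density unit_lborel (\<lambda>x. ennreal (g x)))"
proof
  have [measurable]: "g \<in> borel_measurable unit_lborel"
    using assms by (simp add: probability_density_on_unit_def)
  show "emeasure (density unit_lborel (\<lambda>x. ennreal (g x)))
      (space (density unit_lborel (\<lambda>x. ennreal (g x)))) = 1"
    using assms unfolding probability_density_on_unit_def
    by (subst emeasure_density) (auto intro!: nn_integral_cong simp flip: space_unit_lborel)
qed

lemma prob_space_sample_law:
  assumes "probability_density_on_unit g"
  shows "prob_space (sample_law g)"
  unfolding sample_law_def
  by (intro prob_space_pair prob_space_design prob_space_gauss assms)

lemma sets_sample_law [measurable_cong]: "sets (sample_law g) = sets (unit_lborel \<Otimes>\<^sub>M borel)"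
  unfolding sample_law_def by (intro sets_pair_measure_cong) auto

text \<open>Passing from \<open>f\<close> to \<open>f + h\<close> is expressed as a map of the
  sample space, so that both regression functions can be studied with the same observation map and
  the same estimator.\<close>

definition noise_shift :: "(real \<Rightarrow> real) \<Rightarrow> real \<times> real \<Rightarrow> real \<times> real" where
  "noise_shift h = (\<lambda>(x, \<xi>). (x, \<xi> + h x))"

text \<open>The Radon-Nikodym derivative, with respect to \<open>sample_law g\<close>, of the law of
  a pair whose noise has been shifted by \<open>h x\<close>.\<close>

definition likelihood :: "(real \<Rightarrow> real) \<Rightarrow> real \<times> real \<Rightarrow> real" where
  "likelihood h = (\<lambda>(x, \<xi>). exp (h x * \<xi> - (h x)\<^sup>2 / 2))"

lemma measurable_noise_shift [measurable]:
  assumes [measurable]: "h \<in> borel_measurable unit_lborel"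
  shows "noise_shift h \<in> measurable (unit_lborel \<Otimes>\<^sub>M borel) (unit_lborel \<Otimes>\<^sub>M borel)"
  unfolding noise_shift_def by measurable

lemma measurable_likelihood [measurable]:
  assumes [measurable]: "h \<in> borel_measurable unit_lborel"
  shows "likelihood h \<in> borel_measurable (unit_lborel \<Otimes>\<^sub>M borel)"
  unfolding likelihood_def by measurable

lemma nn_integral_sample_law:
  assumes [measurable]: "F \<in> borel_measurable (unit_lborel \<Otimes>\<^sub>M borel)"
    and "probability_density_on_unit g"
  shows "(\<integral>\<^sup>+z. F z \<partial>sample_law g) =
    (\<integral>\<^sup>+x. ennreal (g x) * (\<integral>\<^sup>+\<xi>. F (x, \<xi>) \<partial>gauss) \<partial>unit_lborel)"
proof -
  interpret G: prob_space gauss by (rule prob_space_gauss)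
  have [measurable]: "g \<in> borel_measurable unit_lborel"
    using assms(2) by (simp add: probability_density_on_unit_def)
  have "F \<in> borel_measurable (density unit_lborel (\<lambda>x. ennreal (g x)) \<Otimes>\<^sub>M gauss)"
    by measurable
  then show ?thesis
    unfolding sample_law_def
    by (subst G.nn_integral_fst[symmetric]) (auto intro!: nn_integral_density)
qed

text \<open>At a fixed design point the shift translates a Gaussian by the constant
  \<open>h x\<close>, so \<open>gauss_shift\<close> applies to each section of \<open>A\<close>; the
  design law itself is not affected.\<close>

lemma distr_noise_shift:
  assumes h [measurable]: "h \<in> borel_measurable unit_lborel"
    and g: "probability_density_on_unit g"
  shows "distr (sample_law g) (sample_law g) (noise_shift h) =
    density (sample_law g) (\<lambda>z. ennreal (likelihood h z))"
proof (rule measure_eqI)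
  fix A assume "A \<in> sets (distr (sample_law g) (sample_law g) (noise_shift h))"
  then have A [measurable]: "A \<in> sets (unit_lborel \<Otimes>\<^sub>M borel)"
    by (simp add: sets_sample_law)
  then have A' [measurable]: "A \<in> sets (sample_law g)"
    by (simp add: sets_sample_law)
  \<comment> \<open>\<open>gauss_shift\<close> concerns functions of the noise alone, so the
    sections of \<open>A\<close> at points of [0,1] have to be Borel.\<close>
  have slice: "(\<lambda>\<xi>. indicator A (x, \<xi>) :: ennreal) \<in> borel_measurable borel" if "x \<in> {0..1}" for x
    by (rule measurable_compose[OF measurable_Pair1' borel_measurable_indicator[OF A]]) (use that in simp)
  have "emeasure (distr (sample_law g) (sample_law g) (noise_shift h)) A =
      (\<integral>\<^sup>+z. indicator A z \<partial>distr (sample_law g) (sample_law g) (noise_shift h))"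
    by (rule nn_integral_indicator[symmetric]) simp
  also have "\<dots> = (\<integral>\<^sup>+z. indicator A (noise_shift h z) \<partial>sample_law g)"
    by (rule nn_integral_distr) simp_all
  also have "\<dots> = (\<integral>\<^sup>+x. ennreal (g x) * (\<integral>\<^sup>+\<xi>. indicator A (x, \<xi> + h x) \<partial>gauss) \<partial>unit_lborel)"
    by (subst nn_integral_sample_law[OF _ g]) (simp_all add: noise_shift_def)
  also have "\<dots> = (\<integral>\<^sup>+x. ennreal (g x) *
      (\<integral>\<^sup>+\<xi>. indicator A (x, \<xi>) * ennreal (likelihood h (x, \<xi>)) \<partial>gauss) \<partial>unit_lborel)"
    by (rule nn_integral_cong) (simp add: likelihood_def gauss_shift[OF slice] del: atLeastAtMost_iff)
  also have "\<dots> = (\<integral>\<^sup>+z. indicator A z * ennreal (likelihood h z) \<partial>sample_law g)"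
    by (subst nn_integral_sample_law[OF _ g]) simp_all
  also have "\<dots> = emeasure (density (sample_law g) (\<lambda>z. ennreal (likelihood h z))) A"
    by (subst emeasure_density) (simp_all add: mult.commute)
  finally show "emeasure (distr (sample_law g) (sample_law g) (noise_shift h)) A =
    emeasure (density (sample_law g) (\<lambda>z. ennreal (likelihood h z))) A" .
qed simp

text \<open>Conditionally on \<open>x\<close>, squaring gives the factor exp (- (h x)^2) and the
  exponential moment at 2 h x gives exp (2 (h x)^2). The value minus one is the chi-square distance
  between the two laws of one observation.\<close>

lemma likelihood_second_moment:
  assumes [measurable]: "h \<in> borel_measurable unit_lborel"
    and g: "probability_density_on_unit g"
  shows "(\<integral>\<^sup>+z. ennreal ((likelihood h z)\<^sup>2) \<partial>sample_law g) =
    (\<integral>\<^sup>+x. ennreal (g x * exp ((h x)\<^sup>2)) \<partial>unit_lborel)"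
proof -
  have "(\<integral>\<^sup>+\<xi>. ennreal ((likelihood h (x, \<xi>))\<^sup>2) \<partial>gauss) = ennreal (exp ((h x)\<^sup>2))" for x
  proof -
    have "(\<integral>\<^sup>+\<xi>. ennreal ((likelihood h (x, \<xi>))\<^sup>2) \<partial>gauss) =
        (\<integral>\<^sup>+\<xi>. ennreal (exp (- (h x)\<^sup>2)) * ennreal (exp ((2 * h x) * \<xi>)) \<partial>gauss)"
      by (simp add: likelihood_def power2_eq_square algebra_simps flip: exp_add ennreal_mult')
    also have "\<dots> = ennreal (exp (- (h x)\<^sup>2)) * ennreal (exp ((2 * h x)\<^sup>2 / 2))"
      by (subst nn_integral_cmult) (simp_all only: gauss_exp_moment, measurable)
    also have "\<dots> = ennreal (exp ((h x)\<^sup>2))"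
      by (simp flip: ennreal_mult' exp_add)
    finally show ?thesis .
  qed
  then show ?thesis
    using g by (subst nn_integral_sample_law[OF _ g])
      (auto intro!: nn_integral_cong simp: ennreal_mult' probability_density_on_unit_def)
qed

section \<open>From one observation to \<open>n\<close> independent ones\<close>

lemma PiM_density:
  assumes "finite I" "prob_space M" "prob_space (density M f)"
    and [measurable]: "f \<in> borel_measurable M"
  shows "PiM I (\<lambda>_. density M f) = density (PiM I (\<lambda>_. M)) (\<lambda>\<omega>. \<Prod>i\<in>I. f (\<omega> i))"
proof -
  interpret M: prob_space M by fact
  interpret D: prob_space "density M f" by fact
  interpret PM: product_prob_space "\<lambda>_. M" I ..
  interpret PD: product_prob_space "\<lambda>_. density M f" I ..
  have prod [measurable]: "(\<lambda>\<omega>. \<Prod>i\<in>I. f (\<omega> i)) \<in> borel_measurable (PiM I (\<lambda>_. M))"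
    by measurable
  show ?thesis
  proof (rule PD.PiM_eqI[symmetric])
    show "sets (density (PiM I (\<lambda>_. M)) (\<lambda>\<omega>. \<Prod>i\<in>I. f (\<omega> i))) = sets (PiM I (\<lambda>_. density M f))"
      by (auto intro!: sets_PiM_cong)
    fix A assume A: "\<And>i. i \<in> I \<Longrightarrow> A i \<in> sets (density M f)"
    then have [measurable]: "Pi\<^sub>E I A \<in> sets (PiM I (\<lambda>_. M))"
      by (intro sets_PiM_I_finite) (auto simp: assms)
    have "emeasure (density (PiM I (\<lambda>_. M)) (\<lambda>\<omega>. \<Prod>i\<in>I. f (\<omega> i))) (Pi\<^sub>E I A) =
        (\<integral>\<^sup>+\<omega>. (\<Prod>i\<in>I. f (\<omega> i)) * indicator (Pi\<^sub>E I A) \<omega> \<partial>PiM I (\<lambda>_. M))"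
      by (rule emeasure_density) measurable
    also have "\<dots> = (\<integral>\<^sup>+\<omega>. (\<Prod>i\<in>I. f (\<omega> i) * indicator (A i) (\<omega> i)) \<partial>PiM I (\<lambda>_. M))"
    proof (rule nn_integral_cong)
      fix \<omega> assume "\<omega> \<in> space (PiM I (\<lambda>_. M))"
      \<comment> \<open>Points of the product space are extensional, so lying in the box is a
        condition on the coordinates in \<open>I\<close> alone, and its indicator
        factorizes.\<close>
      then have "\<omega> \<in> Pi\<^sub>E I A \<longleftrightarrow> (\<forall>i\<in>I. \<omega> i \<in> A i)"
        by (auto simp: space_PiM PiE_iff)
      then have "indicator (Pi\<^sub>E I A) \<omega> = (\<Prod>i\<in>I. indicator (A i) (\<omega> i) :: ennreal)"
        using assms(1) by (auto simp: indicator_def prod_zero_iff)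
      then show "(\<Prod>i\<in>I. f (\<omega> i)) * indicator (Pi\<^sub>E I A) \<omega> = (\<Prod>i\<in>I. f (\<omega> i) * indicator (A i) (\<omega> i))"
        by (simp add: prod.distrib)
    qed
    also have "\<dots> = (\<Prod>i\<in>I. \<integral>\<^sup>+x. f x * indicator (A i) x \<partial>M)"
      using A by (intro PM.product_nn_integral_prod) (auto simp: assms)
    also have "\<dots> = (\<Prod>i\<in>I. emeasure (density M f) (A i))"
      using A by (intro prod.cong refl) (auto simp: emeasure_density)
    finally show "emeasure (density (PiM I (\<lambda>_. M)) (\<lambda>\<omega>. \<Prod>i\<in>I. f (\<omega> i))) (Pi\<^sub>E I A) =
      (\<Prod>i\<in>I. emeasure (density M f) (A i))" .
  qed (use assms in auto)
qed

lemma sample_space_eq: "sample_space g n = PiM {1..n} (\<lambda>_. sample_law g)"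
  by (simp add: sample_space_def sample_law_def gauss_def)

definition sample_likelihood :: "nat \<Rightarrow> (real \<Rightarrow> real) \<Rightarrow> (nat \<Rightarrow> real \<times> real) \<Rightarrow> ennreal" where
  "sample_likelihood n h \<omega> = (\<Prod>i\<in>{1..n}. ennreal (likelihood h (\<omega> i)))"

lemma measurable_sample_likelihood [measurable]:
  assumes [measurable]: "h \<in> borel_measurable unit_lborel"
  shows "sample_likelihood n h \<in> borel_measurable (sample_space g n)"
  unfolding sample_likelihood_def sample_space_eq by measurable

text \<open>The shift acts on each coordinate separately, so image measure and product commute, and
  a product of densities is a density of the product. Risks at \<open>f + h\<close> thus become
  weighted risks at \<open>f\<close>.\<close>

lemma nn_integral_noise_shift:
  assumes h [measurable]: "h \<in> borel_measurable unit_lborel"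
    and g: "probability_density_on_unit g"
    and F [measurable]: "F \<in> borel_measurable (sample_space g n)"
  shows "(\<integral>\<^sup>+\<omega>. F (compose {1..n} (noise_shift h) \<omega>) \<partial>sample_space g n) =
    (\<integral>\<^sup>+\<omega>. sample_likelihood n h \<omega> * F \<omega> \<partial>sample_space g n)"
proof -
  let ?S = "sample_law g" and ?I = "{1..n}"
  interpret S: prob_space ?S by (rule prob_space_sample_law[OF g])
  have ns [measurable]: "noise_shift h \<in> measurable ?S ?S"
    by measurable
  have pd: "prob_space (density ?S (\<lambda>z. ennreal (likelihood h z)))"
    unfolding distr_noise_shift[OF h g, symmetric] by (rule S.prob_space_distr) measurable
  have "distr (PiM ?I (\<lambda>_. ?S)) (PiM ?I (\<lambda>_. ?S)) (compose ?I (noise_shift h)) =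
      PiM ?I (\<lambda>_. distr ?S ?S (noise_shift h))"
    by (rule distr_PiM_finite_prob_space') (auto simp: S.prob_space_axioms)
  also have "\<dots> = density (PiM ?I (\<lambda>_. ?S)) (sample_likelihood n h)"
    unfolding distr_noise_shift[OF h g] sample_likelihood_def
    by (rule PiM_density) (auto simp: S.prob_space_axioms pd)
  finally have eq: "distr (sample_space g n) (sample_space g n) (compose ?I (noise_shift h)) =
      density (sample_space g n) (sample_likelihood n h)"
    by (simp add: sample_space_eq)
  have ms [measurable]: "compose ?I (noise_shift h) \<in> measurable (sample_space g n) (sample_space g n)"
    unfolding compose_def sample_space_eq by measurable
  have "(\<integral>\<^sup>+\<omega>. F (compose ?I (noise_shift h) \<omega>) \<partial>sample_space g n) =
      (\<integral>\<^sup>+\<omega>. F \<omega> \<partial>distr (sample_space g n) (sample_space g n) (compose ?I (noise_shift h)))"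
    by (rule nn_integral_distr[symmetric, OF ms]) simp
  also have "\<dots> = (\<integral>\<^sup>+\<omega>. sample_likelihood n h \<omega> * F \<omega> \<partial>sample_space g n)"
    unfolding eq by (rule nn_integral_density) measurable
  finally show ?thesis .
qed

lemma prob_space_sample_space:
  assumes "probability_density_on_unit g"
  shows "prob_space (sample_space g n)"
  unfolding sample_space_eq by (intro prob_space_PiM prob_space_sample_law assms)

lemma nn_integral_sample_likelihood:
  assumes h: "h \<in> borel_measurable unit_lborel"
    and g: "probability_density_on_unit g"
  shows "(\<integral>\<^sup>+\<omega>. sample_likelihood n h \<omega> \<partial>sample_space g n) = 1"
  using nn_integral_noise_shift[OF h g, of "\<lambda>_. 1" n]
  by (simp add: prob_space.emeasure_space_1[OF prob_space_sample_space[OF g]])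

lemma nn_integral_sample_likelihood_square:
  assumes h [measurable]: "h \<in> borel_measurable unit_lborel"
    and g: "probability_density_on_unit g"
  shows "(\<integral>\<^sup>+\<omega>. (sample_likelihood n h \<omega>)\<^sup>2 \<partial>sample_space g n) =
    (\<integral>\<^sup>+x. ennreal (g x * exp ((h x)\<^sup>2)) \<partial>unit_lborel) ^ n"
proof -
  interpret S: prob_space "sample_law g" by (rule prob_space_sample_law[OF g])
  interpret PS: product_prob_space "\<lambda>_. sample_law g" "{1..n}" ..
  have "(\<integral>\<^sup>+\<omega>. (sample_likelihood n h \<omega>)\<^sup>2 \<partial>sample_space g n) =
      (\<integral>\<^sup>+\<omega>. (\<Prod>i\<in>{1..n}. ennreal ((likelihood h (\<omega> i))\<^sup>2)) \<partial>sample_space g n)"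
    unfolding sample_likelihood_def
    by (simp add: prod_power_distrib ennreal_power likelihood_def split_beta)
  also have "\<dots> = (\<Prod>i\<in>{1..n}. \<integral>\<^sup>+z. ennreal ((likelihood h z)\<^sup>2) \<partial>sample_law g)"
    unfolding sample_space_eq by (intro PS.product_nn_integral_prod) auto
  finally show ?thesis
    by (simp add: likelihood_second_moment[OF h g])
qed

text \<open>The two sides differ only in where \<open>h x\<close> is added: to the regression
  function or to the noise.\<close>

lemma observations_noise_shift:
  "observations n (\<lambda>x. f x + h x) \<omega> = observations n f (compose {1..n} (noise_shift h) \<omega>)"
  by (rule ext) (simp add: observations_def compose_def noise_shift_def split_beta)

lemma measurable_observations [measurable]:
  assumes [measurable]: "f \<in> borel_measurable unit_lborel"
  shows "observations n f \<in> measurable (sample_space g n) (observation_space n)"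
proof -
  have id [measurable]: "(\<lambda>x. x) \<in> borel_measurable unit_lborel"
    by (intro borel_measurable_unit_lborel) simp
  have "(\<lambda>(x, \<xi>). (x, f x + \<xi>)) \<in> measurable (sample_law g) (borel \<Otimes>\<^sub>M borel)"
    by measurable
  then have [measurable]: "(\<lambda>(x, \<xi>). (x, f x + \<xi>)) \<in> measurable (sample_law g) borel"
    by (simp add: borel_prod)
  show ?thesis
    unfolding observations_def observation_space_def sample_space_eq by measurable
qed

text \<open>
  With \<open>L\<close> the likelihood ratio, \<open>min 1 L \<ge> L - L\<^sup>2 / 4\<close>, so only the second moment of \<open>L\<close> matters.
\<close>

lemma two_point_pointwise:
  fixes L t c :: real
  assumes "L \<ge> 0"
  shows "c\<^sup>2 / 2 * L \<le> t\<^sup>2 + L * (t - c)\<^sup>2 + c\<^sup>2 / 8 * L\<^sup>2"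
proof -
  have "t\<^sup>2 + (t - c)\<^sup>2 - c\<^sup>2 / 2 = 2 * (t - c / 2)\<^sup>2"
    by (simp add: power2_eq_square field_simps)
  then have sum: "t\<^sup>2 + (t - c)\<^sup>2 \<ge> c\<^sup>2 / 2"
    using zero_le_power2[of "t - c / 2"] by linarith
  have min: "min 1 L * (t\<^sup>2 + (t - c)\<^sup>2) \<le> t\<^sup>2 + L * (t - c)\<^sup>2"
    using assms by (simp add: min_def distrib_left mult_right_mono mult_le_cancel_right1)
      (smt (verit) mult_left_le_one_le mult_le_cancel_right1 zero_le_power2)
  have "L - L\<^sup>2 / 4 \<le> min 1 L"
    using zero_le_power2[of "L / 2 - 1"] by (auto simp: min_def power2_eq_square field_simps)
  then have "(L - L\<^sup>2 / 4) * (c\<^sup>2 / 2) \<le> min 1 L * (c\<^sup>2 / 2)"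
    by (intro mult_right_mono) auto
  also have "\<dots> \<le> min 1 L * (t\<^sup>2 + (t - c)\<^sup>2)"
    using sum assms by (intro mult_left_mono) auto
  also note min
  finally show ?thesis
    by (simp add: algebra_simps power2_eq_square)
qed

text \<open>The pointwise inequality is integrated with \<open>t\<close> evaluated at the data under
  \<open>f\<close>. The likelihood ratio has mean one, which leaves c^2/2 on the left; the bound 2
  on its second moment takes away c^2/4.\<close>

lemma two_point_bound:
  assumes f [measurable]: "f \<in> borel_measurable unit_lborel"
    and h [measurable]: "h \<in> borel_measurable unit_lborel"
    and g: "probability_density_on_unit g"
    and chi: "(\<integral>\<^sup>+x. ennreal (g x * exp ((h x)\<^sup>2)) \<partial>unit_lborel) ^ n \<le> 2"
    and t [measurable]: "t \<in> borel_measurable (observation_space n)"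
  shows "ennreal (c\<^sup>2 / 4) \<le>
    (\<integral>\<^sup>+\<omega>. ennreal ((t (observations n f \<omega>))\<^sup>2) \<partial>sample_space g n) +
    (\<integral>\<^sup>+\<omega>. ennreal ((t (observations n (\<lambda>x. f x + h x) \<omega>) - c)\<^sup>2) \<partial>sample_space g n)"
    (is "_ \<le> ?R0 + ?R1")
proof -
  let ?P = "sample_space g n" and ?L = "sample_likelihood n h"
  let ?t = "\<lambda>\<omega>. t (observations n f \<omega>)"
  have R1: "?R1 = (\<integral>\<^sup>+\<omega>. ?L \<omega> * ennreal ((?t \<omega> - c)\<^sup>2) \<partial>?P)"
    unfolding observations_noise_shift by (rule nn_integral_noise_shift[OF h g]) measurable
  have L2: "(\<integral>\<^sup>+\<omega>. (?L \<omega>)\<^sup>2 \<partial>?P) \<le> 2"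
    using chi nn_integral_sample_likelihood_square[OF h g] by simp
  have pw: "ennreal (c\<^sup>2 / 2) * ?L \<omega> \<le>
      ennreal ((?t \<omega>)\<^sup>2) + ?L \<omega> * ennreal ((?t \<omega> - c)\<^sup>2) + ennreal (c\<^sup>2 / 8) * (?L \<omega>)\<^sup>2" for \<omega>
  proof -
    define l where "l = (\<Prod>i\<in>{1..n}. likelihood h (\<omega> i))"
    have nonneg: "likelihood h z \<ge> 0" for z
      by (simp add: likelihood_def split_beta)
    then have l: "l \<ge> 0" "?L \<omega> = ennreal l"
      unfolding l_def sample_likelihood_def by (simp_all only: prod_nonneg prod_ennreal)
    show ?thesis
      using two_point_pointwise[OF l(1), of c "?t \<omega>"] l(1)
      unfolding l(2) by (simp add: ennreal_power flip: ennreal_mult' ennreal_plus)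
  qed
  have "ennreal (c\<^sup>2 / 2) = (\<integral>\<^sup>+\<omega>. ennreal (c\<^sup>2 / 2) * ?L \<omega> \<partial>?P)"
    by (subst nn_integral_cmult) (simp_all add: nn_integral_sample_likelihood[OF h g])
  also have "\<dots> \<le> (\<integral>\<^sup>+\<omega>. ennreal ((?t \<omega>)\<^sup>2) + ?L \<omega> * ennreal ((?t \<omega> - c)\<^sup>2) +
      ennreal (c\<^sup>2 / 8) * (?L \<omega>)\<^sup>2 \<partial>?P)"
    by (intro nn_integral_mono pw)
  also have "\<dots> = ?R0 + ?R1 + ennreal (c\<^sup>2 / 8) * (\<integral>\<^sup>+\<omega>. (?L \<omega>)\<^sup>2 \<partial>?P)"
    unfolding R1 by (simp add: nn_integral_add nn_integral_cmult)
  also have "\<dots> \<le> ?R0 + ?R1 + ennreal (c\<^sup>2 / 8) * 2"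
    by (intro add_left_mono mult_left_mono L2) simp
  also have "ennreal (c\<^sup>2 / 8) * 2 = ennreal (c\<^sup>2 / 4)"
    by (simp flip: ennreal_numeral ennreal_mult')
  \<comment> \<open>Both sides carry the same finite summand, the form in which cancellation in
    \<open>ennreal\<close> is valid.\<close>
  finally have "ennreal (c\<^sup>2 / 4) + ennreal (c\<^sup>2 / 4) \<le> (?R0 + ?R1) + ennreal (c\<^sup>2 / 4)"
    by (simp flip: ennreal_plus)
  then show ?thesis
    by (simp add: ennreal_add_left_cancel_le add.commute)
qed


section \<open>Assouad's bound\<close>

lemma sigma_finite_unit_lborel: "sigma_finite_measure unit_lborel"
  unfolding unit_lborel_def by (intro sigma_finite_measure_restrict_space lborel.sigma_finite_measure_axioms) simp

section \<open>Inner products, orthonormal sums and Bessel's inequality\<close>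

lemma L2_integrable_mult:
  assumes "u \<in> L2 M" "v \<in> L2 M"
  shows "integrable M (\<lambda>x. u x * v x)"
proof -
  have [measurable]: "u \<in> borel_measurable M" "v \<in> borel_measurable M"
    and int: "integrable M (\<lambda>x. (u x)\<^sup>2)" "integrable M (\<lambda>x. (v x)\<^sup>2)"
    using assms by (auto simp: L2_def)
  show ?thesis
  proof (rule Bochner_Integration.integrable_bound[OF Bochner_Integration.integrable_add[OF int]])
    have "\<bar>a * b\<bar> \<le> a\<^sup>2 + b\<^sup>2" for a b :: real
    proof -
      have "2 * (\<bar>a\<bar> * \<bar>b\<bar>) \<le> \<bar>a\<bar>\<^sup>2 + \<bar>b\<bar>\<^sup>2"
        using sum_squares_bound[of "\<bar>a\<bar>" "\<bar>b\<bar>"] by simp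
      moreover have "0 \<le> \<bar>a\<bar> * \<bar>b\<bar>"
        by simp
      ultimately show ?thesis
        unfolding abs_mult by (simp only: power2_abs)
    qed
    then show "AE x in M. norm (u x * v x) \<le> norm ((u x)\<^sup>2 + (v x)\<^sup>2)"
      by simp
  qed measurable
qed

lemma L2_add: "u \<in> L2 M \<Longrightarrow> v \<in> L2 M \<Longrightarrow> (\<lambda>x. u x + v x) \<in> L2 M"
  using L2_integrable_mult[of u M v] by (auto simp: L2_def power2_sum mult.assoc)

lemma L2_cmult: "u \<in> L2 M \<Longrightarrow> (\<lambda>x. c * u x) \<in> L2 M"
  by (auto simp: L2_def power_mult_distrib)

lemma L2_zero: "(\<lambda>x. 0) \<in> L2 M"
  by (simp add: L2_def)

lemma L2_sum: "(\<And>k. k \<in> K \<Longrightarrow> u k \<in> L2 M) \<Longrightarrow> (\<lambda>x. \<Sum>k\<in>K. u k x) \<in> L2 M"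
  by (induction K rule: infinite_finite_induct) (auto simp: L2_zero L2_add)

lemma L2_diff: "u \<in> L2 M \<Longrightarrow> v \<in> L2 M \<Longrightarrow> (\<lambda>x. u x - v x) \<in> L2 M"
  using L2_add[of u M "\<lambda>x. - 1 * v x"] L2_cmult[of v M "-1"] by simp

lemma L2_inner_cmult_left: "L2_inner M (\<lambda>x. c * u x) w = c * L2_inner M u w"
  by (simp add: L2_inner_def mult.assoc)

lemma L2_inner_diff_left:
  assumes "u \<in> L2 M" "v \<in> L2 M" "w \<in> L2 M"
  shows "L2_inner M (\<lambda>x. u x - v x) w = L2_inner M u w - L2_inner M v w"
  using assms by (simp add: L2_inner_def left_diff_distrib L2_integrable_mult)

lemma L2_inner_sum_left:
  assumes "\<And>k. k \<in> K \<Longrightarrow> u k \<in> L2 M" "w \<in> L2 M"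
  shows "L2_inner M (\<lambda>x. \<Sum>k\<in>K. u k x) w = (\<Sum>k\<in>K. L2_inner M (u k) w)"
  using assms by (simp add: L2_inner_def sum_distrib_right L2_integrable_mult Bochner_Integration.integral_sum)

lemma L2_inner_commute: "L2_inner M u v = L2_inner M v u"
  by (simp add: L2_inner_def mult.commute)

lemma L2_inner_orthonormal_sum:
  assumes "finite K" and e: "\<And>k. k \<in> K \<Longrightarrow> e k \<in> L2 M"
    and on: "\<And>k l. k \<in> K \<Longrightarrow> l \<in> K \<Longrightarrow> L2_inner M (e k) (e l) = (if k = l then 1 else 0)"
    and "S \<subseteq> K" "l \<in> K"
  shows "L2_inner M (\<lambda>x. \<Sum>k\<in>S. a k * e k x) (e l) = (if l \<in> S then a l else 0)"
proof -
  have "finite S"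
    using assms finite_subset by blast
  have "L2_inner M (\<lambda>x. \<Sum>k\<in>S. a k * e k x) (e l) = (\<Sum>k\<in>S. a k * L2_inner M (e k) (e l))"
    using assms by (subst L2_inner_sum_left) (auto simp: L2_cmult L2_inner_cmult_left subset_eq)
  also have "\<dots> = (\<Sum>k\<in>S. if k = l then a k else 0)"
    using assms by (intro sum.cong) auto
  finally show ?thesis
    using \<open>finite S\<close> by simp
qed

text \<open>Nonnegativity of the squared norm of \<open>v - w\<close>, where \<open>w\<close> is the
  projection of \<open>v\<close> on the span of the \<open>e k\<close>: its inner products with
  \<open>v\<close> and with itself coincide.\<close>

lemma bessel_inequality:
  assumes K: "finite K" and e: "\<And>k. k \<in> K \<Longrightarrow> e k \<in> L2 M"
    and on: "\<And>k l. k \<in> K \<Longrightarrow> l \<in> K \<Longrightarrow> L2_inner M (e k) (e l) = (if k = l then 1 else 0)"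
    and v: "v \<in> L2 M"
  shows "(\<Sum>k\<in>K. (L2_inner M v (e k))\<^sup>2) \<le> L2_inner M v v"
proof -
  define a where "a k = L2_inner M v (e k)" for k
  define w where "w = (\<lambda>x. \<Sum>k\<in>K. a k * e k x)"
  have w: "w \<in> L2 M"
    unfolding w_def by (intro L2_sum L2_cmult e)
  have vw: "L2_inner M w v = (\<Sum>k\<in>K. (a k)\<^sup>2)"
    unfolding w_def using e v
    by (subst L2_inner_sum_left)
      (auto simp: L2_cmult L2_inner_cmult_left a_def power2_eq_square L2_inner_commute[of M _ v])
  have ww: "L2_inner M w w = (\<Sum>k\<in>K. (a k)\<^sup>2)"
  proof -
    have "L2_inner M w w = (\<Sum>k\<in>K. a k * L2_inner M (e k) w)"
      by (subst w_def, subst L2_inner_sum_left) (auto simp: L2_cmult e w L2_inner_cmult_left)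
    also have "\<dots> = (\<Sum>k\<in>K. (a k)\<^sup>2)"
      unfolding w_def
      by (intro sum.cong) (auto simp: L2_inner_commute[of M "e _"] power2_eq_square
          L2_inner_orthonormal_sum[OF K e on])
    finally show ?thesis .
  qed
  have "0 \<le> L2_inner M (\<lambda>x. v x - w x) (\<lambda>x. v x - w x)"
    unfolding L2_inner_def by (rule Bochner_Integration.integral_nonneg) simp
  also have "\<dots> = L2_inner M v v - 2 * L2_inner M w v + L2_inner M w w"
    using v w by (simp add: L2_inner_diff_left L2_diff L2_inner_commute[of M v "\<lambda>x. v x - w x"]
        L2_inner_commute[of M w "\<lambda>x. v x - w x"] L2_inner_commute[of M v w])
  finally show ?thesis
    by (simp add: vw ww a_def)
qed

text \<open>Here the joint measurability of an estimator in data and argument enters: each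
  coefficient of the estimate becomes a real-valued statistic, the form demanded by
  \<open>two_point_bound\<close>.\<close>

lemma measurable_estimator_coefficient:
  assumes T: "T \<in> estimators n" and [measurable]: "e \<in> borel_measurable unit_lborel"
  shows "(\<lambda>d. L2_inner unit_lborel (T d) e) \<in> borel_measurable (observation_space n)"
proof -
  interpret sigma_finite_measure unit_lborel by (rule sigma_finite_unit_lborel)
  have [measurable]: "(\<lambda>(d, t). T d t) \<in> borel_measurable (observation_space n \<Otimes>\<^sub>M unit_lborel)"
    using T by (simp add: estimators_def)
  have "(\<lambda>z. (case z of (d, t) \<Rightarrow> T d t) * e (snd z)) \<in> borel_measurable (observation_space n \<Otimes>\<^sub>M unit_lborel)"
    by measurable
  then show ?thesis
    unfolding L2_inner_def
    by (intro borel_measurable_lebesgue_integral) (simp add: split_beta)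
qed

text \<open>The vertices of the cube are paired along direction \<open>k\<close>, each pair being
  represented by its vertex without \<open>k\<close>.\<close>

lemma sum_Pow_split:
  fixes \<rho> :: "'a set \<Rightarrow> 'b::comm_monoid_add"
  assumes "finite K" "k \<in> K"
  shows "(\<Sum>S\<in>Pow K. \<rho> S) = (\<Sum>S\<in>Pow (K - {k}). \<rho> S + \<rho> (insert k S))"
proof -
  have K: "K = insert k (K - {k})"
    using assms by auto
  have "(\<Sum>S\<in>Pow K. \<rho> S) = (\<Sum>S\<in>Pow (K - {k}) \<union> insert k ` Pow (K - {k}). \<rho> S)"
    by (subst K) (simp only: Pow_insert)
  also have "\<dots> = (\<Sum>S\<in>Pow (K - {k}). \<rho> S) + (\<Sum>S\<in>insert k ` Pow (K - {k}). \<rho> S)"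
    using assms by (intro sum.union_disjoint) auto
  also have "(\<Sum>S\<in>insert k ` Pow (K - {k}). \<rho> S) = (\<Sum>S\<in>Pow (K - {k}). \<rho> (insert k S))"
    by (subst sum.reindex) (auto simp: inj_on_def)
  finally show ?thesis
    by (simp add: sum.distrib)
qed

text \<open>Bessel's inequality for the error at each sample point, then integration. Estimating the
  function is thereby at least as hard as estimating \<open>card K\<close> real coefficients
  simultaneously.\<close>

lemma risk_ge_coefficient_risk:
  assumes K: "finite K" and e: "\<And>k. k \<in> K \<Longrightarrow> e k \<in> L2 unit_lborel"
    and on: "\<And>k l. k \<in> K \<Longrightarrow> l \<in> K \<Longrightarrow> L2_inner unit_lborel (e k) (e l) = (if k = l then 1 else 0)"
    and T: "T \<in> estimators n" and f: "f \<in> L2 unit_lborel"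
  shows "(\<Sum>k\<in>K. \<integral>\<^sup>+\<omega>. ennreal ((L2_inner unit_lborel (T (observations n f \<omega>)) (e k) -
      L2_inner unit_lborel f (e k))\<^sup>2) \<partial>sample_space g n) \<le> risk g n T f"
proof -
  have [measurable]: "f \<in> borel_measurable unit_lborel" "\<And>k. k \<in> K \<Longrightarrow> e k \<in> borel_measurable unit_lborel"
    using f e by (auto simp: L2_def)
  have meas: "(\<lambda>\<omega>. ennreal ((L2_inner unit_lborel (T (observations n f \<omega>)) (e k) -
      L2_inner unit_lborel f (e k))\<^sup>2)) \<in> borel_measurable (sample_space g n)" if "k \<in> K" for k
  proof -
    have [measurable]: "(\<lambda>d. L2_inner unit_lborel (T d) (e k)) \<in> borel_measurable (observation_space n)"
      using that by (intro measurable_estimator_coefficient[OF T]) measurable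
    show ?thesis
      by measurable
  qed
  have "(\<Sum>k\<in>K. \<integral>\<^sup>+\<omega>. ennreal ((L2_inner unit_lborel (T (observations n f \<omega>)) (e k) -
      L2_inner unit_lborel f (e k))\<^sup>2) \<partial>sample_space g n) =
    (\<integral>\<^sup>+\<omega>. (\<Sum>k\<in>K. ennreal ((L2_inner unit_lborel (T (observations n f \<omega>)) (e k) -
      L2_inner unit_lborel f (e k))\<^sup>2)) \<partial>sample_space g n)"
    by (rule nn_integral_sum[symmetric]) (rule meas)
  also have "\<dots> \<le> risk g n T f"
    unfolding risk_def
  proof (rule nn_integral_mono)
    fix \<omega> assume \<omega>: "\<omega> \<in> space (sample_space g n)"
    define v where "v = T (observations n f \<omega>)"
    \<comment> \<open>Square integrability of \<open>T d\<close> is known only for \<open>d\<close>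
      in the observation space.\<close>
    have "observations n f \<omega> \<in> space (observation_space n)"
      by (rule measurable_space[OF _ \<omega>]) measurable
    then have v: "v \<in> L2 unit_lborel"
      using T by (simp add: v_def estimators_def)
    have d: "(\<lambda>x. v x - f x) \<in> L2 unit_lborel"
      by (rule L2_diff[OF v f])
    have "(\<Sum>k\<in>K. ennreal ((L2_inner unit_lborel v (e k) - L2_inner unit_lborel f (e k))\<^sup>2)) =
        ennreal (\<Sum>k\<in>K. (L2_inner unit_lborel (\<lambda>x. v x - f x) (e k))\<^sup>2)"
      using v f e by (subst sum_ennreal[symmetric]) (auto simp: L2_inner_diff_left)
    also have "\<dots> \<le> ennreal (L2_inner unit_lborel (\<lambda>x. v x - f x) (\<lambda>x. v x - f x))"
      by (intro ennreal_leI bessel_inequality[OF K e on d])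
    also have "\<dots> = (\<integral>\<^sup>+t. ennreal ((v t - f t)\<^sup>2) \<partial>unit_lborel)"
      unfolding L2_inner_def using d
      by (subst nn_integral_eq_integral) (auto simp: L2_def power2_eq_square)
    finally show "(\<Sum>k\<in>K. ennreal ((L2_inner unit_lborel (T (observations n f \<omega>)) (e k) -
        L2_inner unit_lborel f (e k))\<^sup>2)) \<le>
      (\<integral>\<^sup>+t. ennreal ((T (observations n f \<omega>) t - f t)\<^sup>2) \<partial>unit_lborel)"
      unfolding v_def .
  qed
  finally show ?thesis .
qed

text \<open>The supremum dominates the average over all vertices \<open>S \<subseteq> K\<close>. In
  direction \<open>k\<close> there are 2^(card K - 1) pairs of neighbours, each contributing c^2/4,
  against 2^(card K) vertices; this yields c^2/8 per direction. Neighbours differ by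
  \<open>c * e k\<close> whatever \<open>S\<close> is, so \<open>chi\<close> only concerns single
  basis functions.\<close>

lemma minimax_risk_hypercube:
  fixes e :: "'k \<Rightarrow> real \<Rightarrow> real"
  assumes K: "finite K" and e: "\<And>k. k \<in> K \<Longrightarrow> e k \<in> L2 unit_lborel"
    and on: "\<And>k l. k \<in> K \<Longrightarrow> l \<in> K \<Longrightarrow> L2_inner unit_lborel (e k) (e l) = (if k = l then 1 else 0)"
    and g: "probability_density_on_unit g"
    and \<F>: "\<And>S. S \<subseteq> K \<Longrightarrow> (\<lambda>x. \<Sum>k\<in>S. c * e k x) \<in> \<F>"
    and chi: "\<And>k. k \<in> K \<Longrightarrow>
      (\<integral>\<^sup>+x. ennreal (g x * exp ((c * e k x)\<^sup>2)) \<partial>unit_lborel) ^ n \<le> 2"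
  shows "ennreal (real (card K) * c\<^sup>2 / 8) \<le> minimax_risk g n \<F>"
  unfolding minimax_risk_def
proof (rule INF_greatest)
  fix T assume T: "T \<in> estimators n"
  define fS where "fS S = (\<lambda>x. \<Sum>k\<in>S. c * e k x)" for S
  define t where "t k d = L2_inner unit_lborel (T d) (e k)" for k d
  define \<rho> where "\<rho> k S = (\<integral>\<^sup>+\<omega>. ennreal ((t k (observations n (fS S) \<omega>) -
      (if k \<in> S then c else 0))\<^sup>2) \<partial>sample_space g n)" for k S
  have e_meas [measurable]: "e k \<in> borel_measurable unit_lborel" if "k \<in> K" for k
    using e[OF that] by (simp add: L2_def)
  have fS: "fS S \<in> L2 unit_lborel" if "S \<subseteq> K" for S
    unfolding fS_def using that e by (intro L2_sum L2_cmult) auto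
  have risk_ge: "(\<Sum>k\<in>K. \<rho> k S) \<le> (SUP f\<in>\<F>. risk g n T f)" if S: "S \<subseteq> K" for S
  proof -
    have "(\<Sum>k\<in>K. \<rho> k S) = (\<Sum>k\<in>K. \<integral>\<^sup>+\<omega>. ennreal ((L2_inner unit_lborel (T (observations n (fS S) \<omega>)) (e k) -
        L2_inner unit_lborel (fS S) (e k))\<^sup>2) \<partial>sample_space g n)"
      unfolding \<rho>_def t_def fS_def
      by (intro sum.cong refl) (simp add: L2_inner_orthonormal_sum[OF K e on S])
    also have "\<dots> \<le> risk g n T (fS S)"
      by (rule risk_ge_coefficient_risk[OF K e on T fS[OF S]])
    also have "\<dots> \<le> (SUP f\<in>\<F>. risk g n T f)"
      using \<F>[OF S] by (intro SUP_upper) (simp add: fS_def)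
    finally show ?thesis .
  qed
  have pair: "ennreal (c\<^sup>2 / 4) \<le> \<rho> k S + \<rho> k (insert k S)" if k: "k \<in> K" and S: "S \<subseteq> K - {k}" for k S
  proof -
    have "k \<notin> S" "finite S"
      using S K by (auto intro: finite_subset)
    then have ins: "fS (insert k S) = (\<lambda>x. fS S x + c * e k x)"
      by (auto simp: fS_def add.commute)
    have m: "fS S \<in> borel_measurable unit_lborel"
      using fS[of S] S by (auto simp: L2_def)
    have "ennreal (c\<^sup>2 / 4) \<le>
        (\<integral>\<^sup>+\<omega>. ennreal ((t k (observations n (fS S) \<omega>))\<^sup>2) \<partial>sample_space g n) +
        (\<integral>\<^sup>+\<omega>. ennreal ((t k (observations n (\<lambda>x. fS S x + c * e k x) \<omega>) - c)\<^sup>2) \<partial>sample_space g n)"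
      unfolding t_def using k
      by (intro two_point_bound m g chi measurable_estimator_coefficient[OF T]) measurable
    then show ?thesis
      using \<open>k \<notin> S\<close> by (simp add: \<rho>_def ins)
  qed
  \<comment> \<open>The inequality is kept multiplied by the number of vertices, which avoids
    averaging in \<open>ennreal\<close>. The empty \<open>K\<close> is split off because
    \<open>card K - 1\<close> is a natural subtraction.\<close>
  have "of_nat (card (Pow K)) * ennreal (real (card K) * c\<^sup>2 / 8) =
      (\<Sum>k\<in>K. \<Sum>S\<in>Pow (K - {k}). ennreal (c\<^sup>2 / 4))"
  proof (cases "K = {}")
    case False
    have *: "(\<Sum>S\<in>Pow (K - {k}). ennreal (c\<^sup>2 / 4)) = ennreal (2 ^ (card K - 1) * (c\<^sup>2 / 4))" if "k \<in> K" for k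
      using that K by (simp add: card_Pow ennreal_mult' flip: ennreal_power del: times_divide_eq_right)
    have "(2::real) ^ card K = 2 * 2 ^ (card K - 1)"
      using False K by (subst power_Suc[symmetric]) (auto simp: card_gt_0_iff)
    then have **: "2 ^ card K * (real (card K) * c\<^sup>2 / 8) = real (card K) * (2 ^ (card K - 1) * (c\<^sup>2 / 4))"
      by simp
    have "of_nat (card (Pow K)) * ennreal (real (card K) * c\<^sup>2 / 8) =
        ennreal (2 ^ card K * (real (card K) * c\<^sup>2 / 8))"
      using K by (simp add: card_Pow ennreal_mult' flip: ennreal_power del: times_divide_eq_right)
    also have "\<dots> = (\<Sum>k\<in>K. ennreal (2 ^ (card K - 1) * (c\<^sup>2 / 4)))"
      unfolding ** by (simp add: ennreal_mult' ennreal_of_nat_eq_real_of_nat del: times_divide_eq_right)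
    also have "\<dots> = (\<Sum>k\<in>K. \<Sum>S\<in>Pow (K - {k}). ennreal (c\<^sup>2 / 4))"
      by (intro sum.cong refl) (simp only: *)
    finally show ?thesis .
  qed simp
  also have "\<dots> \<le> (\<Sum>k\<in>K. \<Sum>S\<in>Pow (K - {k}). \<rho> k S + \<rho> k (insert k S))"
    by (intro sum_mono pair) auto
  also have "\<dots> = (\<Sum>S\<in>Pow K. \<Sum>k\<in>K. \<rho> k S)"
    by (subst sum.swap) (auto intro!: sum.cong simp: sum_Pow_split[OF K])
  also have "\<dots> \<le> (\<Sum>S\<in>Pow K. (SUP f\<in>\<F>. risk g n T f))"
    by (intro sum_mono risk_ge) auto
  also have "\<dots> = of_nat (card (Pow K)) * (SUP f\<in>\<F>. risk g n T f)"
    by simp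
  finally show "ennreal (real (card K) * c\<^sup>2 / 8) \<le> (SUP f\<in>\<F>. risk g n T f)"
    using K by (subst (asm) ennreal_mult_le_mult_iff) auto
qed


section \<open>Periodized wavelets\<close>

text \<open>Boundedness and compact support together make every product integral finite and every
  periodization locally a finite sum.\<close>

definition bump :: "real \<Rightarrow> (real \<Rightarrow> real) \<Rightarrow> bool" where
  "bump R u \<longleftrightarrow> u \<in> borel_measurable borel \<and> (\<exists>C. \<forall>x. \<bar>u x\<bar> \<le> C) \<and> (\<forall>x. u x \<noteq> 0 \<longrightarrow> \<bar>x\<bar> \<le> R)"

text \<open>Scale and position are left to \<open>u\<close>: \<open>periodized h j k\<close> is this
  operation applied to \<open>dilate_shift h j k\<close>.\<close>

definition periodization :: "(real \<Rightarrow> real) \<Rightarrow> real \<Rightarrow> real" where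
  "periodization u x = (\<Sum>\<^sub>\<infinity>i::int. u (x + of_int i))"

lemma bump_measurable: "bump R u \<Longrightarrow> u \<in> borel_measurable borel"
  by (simp add: bump_def)

lemma bump_mono: "bump R u \<Longrightarrow> R \<le> R' \<Longrightarrow> bump R' u"
  unfolding bump_def by (meson order_trans)

lemma bump_integrable:
  assumes "bump R u"
  shows "integrable lborel u"
proof -
  obtain C where C: "\<And>x. \<bar>u x\<bar> \<le> C"
    using assms by (auto simp: bump_def)
  have [measurable]: "u \<in> borel_measurable borel"
    using assms by (rule bump_measurable)
  have eq: "u = (\<lambda>x. indicator {-R..R} x *\<^sub>R u x)"
    using assms by (auto simp: bump_def indicator_def fun_eq_iff)
  show ?thesis
    by (subst eq, rule integrableI_bounded_set_indicator[of _ _ _ C])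
      (auto simp: C emeasure_lborel_Icc_eq)
qed

lemma bump_mult:
  assumes "bump R u" "v \<in> borel_measurable borel" "\<And>x. \<bar>v x\<bar> \<le> C"
  shows "bump R (\<lambda>x. u x * v x)"
proof -
  obtain B where B: "\<And>x. \<bar>u x\<bar> \<le> B"
    using assms by (auto simp: bump_def)
  have "\<bar>u x * v x\<bar> \<le> B * C" for x
    unfolding abs_mult using B[of x] assms(3)[of x] by (intro mult_mono) auto
  then show ?thesis
    using assms by (auto simp: bump_def)
qed

text \<open>The window \<open>{-N..N}\<close> depends only on the bounds \<open>R\<close> and
  \<open>X\<close>, so one finite sum serves all \<open>x\<close> of an interval, as measurability
  and the exchange with integrals require.\<close>

lemma periodization_eq_sum:
  assumes "bump R u" "\<bar>x\<bar> \<le> X" "R + X \<le> of_int N"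
  shows "periodization u x = (\<Sum>i\<in>{-N..N}. u (x + of_int i))"
proof -
  have "u (x + of_int i) = 0" if "i \<notin> {-N..N}" for i
  proof (rule ccontr)
    assume "u (x + of_int i) \<noteq> 0"
    then have "\<bar>x + of_int i\<bar> \<le> R"
      using assms by (simp add: bump_def)
    then have "\<bar>of_int i\<bar> \<le> (of_int N :: real)"
      using assms(2,3) by linarith
    then have "\<bar>i\<bar> \<le> N"
      by (simp flip: of_int_abs)
    then show False
      using that by auto
  qed
  then have "periodization u x = infsum (\<lambda>i. u (x + of_int i)) {-N..N}"
    unfolding periodization_def by (intro infsum_cong_neutral) auto
  then show ?thesis by simp
qed

lemma periodization_shift: "periodization u (x + of_int l) = periodization u x"
proof -
  have "bij_betw (\<lambda>i. l + i) UNIV (UNIV :: int set)"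
    by (rule bij_betw_byWitness[where f'="\<lambda>i. i - l"]) auto
  from infsum_reindex_bij_betw[OF this, of "\<lambda>i. u (x + of_int i)"] show ?thesis
    by (simp add: periodization_def add.assoc)
qed

lemma periodization_measurable:
  assumes "bump R u"
  shows "periodization u \<in> borel_measurable unit_lborel"
proof -
  have [measurable]: "u \<in> borel_measurable borel"
    using assms by (rule bump_measurable)
  obtain N where "R + 1 \<le> of_int N"
    using ex_le_of_int by blast
  then have "periodization u x = (\<Sum>i\<in>{-N..N}. u (x + of_int i))" if "x \<in> space unit_lborel" for x
    using that by (intro periodization_eq_sum[OF assms, of x 1]) auto
  moreover have "(\<lambda>x. \<Sum>i\<in>{-N..N}. u (x + of_int i)) \<in> borel_measurable unit_lborel"
    by (rule borel_measurable_unit_lborel) measurable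
  ultimately show ?thesis
    by (subst measurable_cong)
qed

text \<open>The endpoint 1 is a null set. The half-open interval is preferred because its integer
  translates partition the line.\<close>

lemma integral_unit_lborel:
  fixes f :: "real \<Rightarrow> real"
  assumes "f \<in> borel_measurable unit_lborel"
  shows "(LINT x|unit_lborel. f x) = (LINT x|lborel. indicator {0..<1} x * f x)"
proof -
  have m: "(\<lambda>x. indicator {0..1} x * f x) \<in> borel_measurable lborel"
    using assms by (simp add: unit_lborel_def borel_measurable_restrict_space_iff)
  have "(\<lambda>x. indicator {0..<1} x * (indicator {0..1} x * f x)) \<in> borel_measurable lborel"
    by (intro borel_measurable_times m) simp
  moreover have "(\<lambda>x. indicator {0..<1} x * (indicator {0..1} x * f x)) = (\<lambda>x. indicator {0..<1} x * f x)"
    by (auto simp: indicator_def)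
  ultimately have m': "(\<lambda>x. indicator {0..<1} x * f x) \<in> borel_measurable lborel"
    by simp
  have "(LINT x|unit_lborel. f x) = (LINT x|lborel. indicator {0..1} x * f x)"
    unfolding unit_lborel_def by (subst integral_restrict_space) simp_all
  also have "\<dots> = (LINT x|lborel. indicator {0..<1} x * f x)"
    using AE_lborel_singleton[of "1::real"]
    by (intro integral_cong_AE m m') (auto elim!: eventually_mono simp: indicator_def)
  finally show ?thesis .
qed

text \<open>
  Cut \<open>\<real>\<close> into unit intervals to replace the periodization of \<open>u\<close> on \<open>[0, 1)\<close> by \<open>u\<close> itself on \<open>\<real>\<close>.
\<close>

lemma integral_periodization_mult:
  assumes u: "bump R u" and v: "bump R v" and N: "2 * R + 2 \<le> of_int N" and R: "R \<ge> 0"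
  shows "(LINT x|unit_lborel. periodization u x * periodization v x) =
    (\<Sum>l\<in>{-N..N}. LINT y|lborel. u y * v (y + of_int l))"
proof -
  define w where "w x = (\<Sum>l\<in>{-N..N}. v (x + of_int l))" for x
  define I :: "real \<Rightarrow> real" where "I = indicator {0..<1}"
  have [measurable]: "u \<in> borel_measurable borel" "v \<in> borel_measurable borel"
    using u v by (auto intro: bump_measurable)
  have [measurable]: "w \<in> borel_measurable borel" "I \<in> borel_measurable borel"
    unfolding w_def I_def by measurable
  obtain C where C: "\<And>x. \<bar>v x\<bar> \<le> C"
    using v by (auto simp: bump_def)
  have "\<bar>w x\<bar> \<le> (\<Sum>l\<in>{-N..N}. C)" for x
    unfolding w_def by (rule order_trans[OF sum_abs sum_mono]) (rule C)
  then have uw: "bump R (\<lambda>y. u y * w y)"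
    by (intro bump_mult[OF u]) simp_all
  \<comment> \<open>\<open>w\<close> is the periodization of \<open>v\<close> cut off to a finite
    window. The two have to agree only where \<open>u\<close> lives, and a window of size 2R is
    enough for that.\<close>
  have w_eq: "w y = periodization v y" if "\<bar>y\<bar> \<le> R" for y
    unfolding w_def using that N R by (intro periodization_eq_sum[OF v, of y R, symmetric]) auto
  have pw: "I x * (periodization u x * periodization v x) =
      (\<Sum>i\<in>{-N..N}. I x * (u (x + of_int i) * w (x + of_int i)))" for x
  proof (cases "x \<in> {0..<1}")
    case True
    have *: "u (x + of_int i) * periodization v x = u (x + of_int i) * w (x + of_int i)" for i
    proof (cases "u (x + of_int i) = 0")
      case False
      then have "\<bar>x + of_int i\<bar> \<le> R"
        using u by (simp add: bump_def)
      then show ?thesis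
        by (simp add: w_eq periodization_shift)
    qed simp
    have "periodization u x = (\<Sum>i\<in>{-N..N}. u (x + of_int i))"
      using True N R by (intro periodization_eq_sum[OF u, of x 1]) auto
    then show ?thesis
      by (simp only: sum_distrib_right * sum_distrib_left)
  qed (simp add: I_def)
  have int: "integrable lborel (\<lambda>y. I (y - of_int i) * (u y * w y))" for i :: int
    using bump_integrable[OF bump_mult[OF uw, of "\<lambda>y. I (y - of_int i)" 1]]
    by (simp add: mult.commute I_def indicator_def)
  have shift: "(LINT x|lborel. I x * (u (x + of_int i) * w (x + of_int i))) =
      (LINT y|lborel. I (y - of_int i) * (u y * w y))" for i
    by (subst lborel_integral_real_affine[where c=1 and t="of_int i" and f="\<lambda>y. I (y - of_int i) * (u y * w y)"])
      (simp_all add: add.commute)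
  have int': "integrable lborel (\<lambda>x. I x * (u (x + of_int i) * w (x + of_int i)))" for i :: int
    using lborel_integrable_real_affine[OF int[of i], of 1 "of_int i"] by (simp add: add.commute)
  \<comment> \<open>Of the translates of [0,1) only the one indexed by the floor of \<open>y\<close>
    contains \<open>y\<close>, and for \<open>y\<close> in the support of \<open>u\<close> this
    index lies in the window.\<close>
  have part: "(\<Sum>i\<in>{-N..N}. I (y - of_int i) * (u y * w y)) = u y * w y" for y
  proof (cases "u y = 0")
    case False
    then have y: "\<bar>y\<bar> \<le> R"
      using u by (simp add: bump_def)
    have "I (y - of_int i) = (if i = \<lfloor>y\<rfloor> then 1 else 0)" for i
      unfolding I_def indicator_def by (auto; linarith)
    moreover have "\<lfloor>y\<rfloor> \<in> {-N..N}"
      using y N R by (auto simp: le_floor_iff floor_le_iff abs_le_iff)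
    ultimately have "(\<Sum>i\<in>{-N..N}. I (y - of_int i)) = 1"
      by simp
    then show ?thesis
      by (simp flip: sum_distrib_right)
  qed simp
  have "(LINT x|unit_lborel. periodization u x * periodization v x) =
      (LINT x|lborel. I x * (periodization u x * periodization v x))"
    unfolding I_def
    by (intro integral_unit_lborel borel_measurable_times periodization_measurable[OF u] periodization_measurable[OF v])
  also have "\<dots> = (\<Sum>i\<in>{-N..N}. LINT x|lborel. I x * (u (x + of_int i) * w (x + of_int i)))"
    unfolding pw by (rule Bochner_Integration.integral_sum) (rule int')
  also have "\<dots> = (LINT y|lborel. (\<Sum>i\<in>{-N..N}. I (y - of_int i) * (u y * w y)))"
    unfolding shift by (rule Bochner_Integration.integral_sum[symmetric]) (rule int)
  also have "\<dots> = (LINT y|lborel. u y * w y)"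
    by (simp only: part)
  also have "\<dots> = (LINT y|lborel. (\<Sum>l\<in>{-N..N}. u y * v (y + of_int l)))"
    by (simp add: w_def sum_distrib_left)
  also have "\<dots> = (\<Sum>l\<in>{-N..N}. LINT y|lborel. u y * v (y + of_int l))"
    by (rule Bochner_Integration.integral_sum) (rule bump_integrable[OF bump_mult[OF u _ C]], measurable)
  finally show ?thesis .
qed

text \<open>Unfolding one factor leaves a sum over the integer translates of the other, so inner
  products on the line with all translates determine the one on the interval.\<close>

lemma L2_inner_periodization:
  assumes u: "bump R u" and v: "bump R' v"
    and inner: "\<And>l::int. L2_inner lborel u (\<lambda>y. v (y + of_int l)) = (if l = 0 then c else 0)"
  shows "L2_inner unit_lborel (periodization u) (periodization v) = c"
proof -
  define R0 where "R0 = max 0 (max R R')"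
  obtain N where N: "2 * R0 + 2 \<le> of_int N"
    using ex_le_of_int by blast
  have "bump R0 u" "bump R0 v"
    using u v by (auto intro: bump_mono simp: R0_def)
  then have "L2_inner unit_lborel (periodization u) (periodization v) =
      (\<Sum>l\<in>{-N..N}. if l = 0 then c else 0)"
    unfolding L2_inner_def using inner
    by (subst integral_periodization_mult[OF _ _ N]) (auto simp: R0_def L2_inner_def)
  also have "\<dots> = c"
    using N by (simp add: R0_def)
  finally show ?thesis .
qed

lemma periodized_eq_periodization: "periodized h j k = periodization (dilate_shift h (int j) (int k))"
  by (rule ext) (simp add: periodized_def periodization_def dilate_shift_def powr_realpow)

text \<open>An integer translation moves the index \<open>k\<close> by a multiple of 2^j, so the
  translates of a basis wavelet are again basis wavelets.\<close>

lemma dilate_shift_add_int: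
  "dilate_shift h (int j) k (y + of_int l) = dilate_shift h (int j) (k - 2 ^ j * l) y"
  by (simp add: dilate_shift_def powr_realpow algebra_simps)

text \<open>The radius is crude: for periodization only its finiteness counts. Sharp localization is
  the subject of \<open>periodized_support\<close>.\<close>

lemma bump_dilate_shift:
  assumes "bump R h"
  shows "bump (R + \<bar>of_int k\<bar>) (dilate_shift h (int j) k)"
  unfolding bump_def
proof (intro conjI allI impI)
  have [measurable]: "h \<in> borel_measurable borel"
    using assms by (rule bump_measurable)
  show "dilate_shift h (int j) k \<in> borel_measurable borel"
    unfolding dilate_shift_def by measurable
  obtain C where C: "\<And>x. \<bar>h x\<bar> \<le> C"
    using assms by (auto simp: bump_def)
  show "\<exists>C. \<forall>x. \<bar>dilate_shift h (int j) k x\<bar> \<le> C"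
    by (rule exI[of _ "2 powr (of_int (int j) / 2) * C"])
      (auto simp: dilate_shift_def abs_mult intro!: mult_left_mono C)
  fix x assume "dilate_shift h (int j) k x \<noteq> 0"
  then have "\<bar>2 ^ j * x - of_int k\<bar> \<le> R"
    using assms by (auto simp: dilate_shift_def bump_def powr_realpow)
  then have "\<bar>2 ^ j * x\<bar> \<le> R + \<bar>of_int k\<bar>"
    by linarith
  moreover have "\<bar>x\<bar> \<le> \<bar>2 ^ j * x\<bar>"
    by (simp add: abs_mult mult_le_cancel_right1)
  ultimately show "\<bar>x\<bar> \<le> R + \<bar>of_int k\<bar>"
    by linarith
qed

text \<open>Indices in [0, 2^j) are pairwise incongruent modulo 2^j, so among the integer translates
  of the second wavelet only the untranslated one can coincide with the first.\<close>

lemma periodized_wavelets_orthonormal: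
  assumes \<psi>: "bump R \<psi>"
    and basis: "L2_orthonormal_basis lborel (L2 lborel) (\<lambda>(j, k). dilate_shift \<psi> j k)"
    and k: "k < 2 ^ j" "k' < 2 ^ j'"
  shows "L2_inner unit_lborel (periodized \<psi> j k) (periodized \<psi> j' k') = (if j = j' \<and> k = k' then 1 else 0)"
  unfolding periodized_eq_periodization
proof (rule L2_inner_periodization[OF bump_dilate_shift[OF \<psi>] bump_dilate_shift[OF \<psi>]])
  fix l :: int
  have "L2_inner lborel (dilate_shift \<psi> (int j) (int k))
      (\<lambda>y. dilate_shift \<psi> (int j') (int k') (y + of_int l)) =
    (if j = j' \<and> int k = int k' - 2 ^ j' * l then 1 else 0)"
    unfolding dilate_shift_add_int
    using basis[unfolded L2_orthonormal_basis_def, THEN conjunct2, THEN conjunct1, rule_format,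
        of "(int j, int k)" "(int j', int k' - 2 ^ j' * l)"]
    by (simp add: eta_contract_eq)
  moreover have "l = 0" if "j = j'" "int k = int k' - 2 ^ j' * l"
  proof (rule ccontr)
    assume "l \<noteq> 0"
    then have "(2::int) ^ j' * 1 \<le> 2 ^ j' * \<bar>l\<bar>"
      by (intro mult_left_mono) auto
    also have "\<dots> = \<bar>int k' - int k\<bar>"
      using that by (simp add: abs_mult)
    also have "\<dots> < 2 ^ j'"
    proof -
      have "int k < 2 ^ j'" "int k' < 2 ^ j'"
        using k \<open>j = j'\<close> by simp_all
      then show ?thesis by linarith
    qed
    finally show False by simp
  qed
  ultimately show "L2_inner lborel (dilate_shift \<psi> (int j) (int k))
      (\<lambda>y. dilate_shift \<psi> (int j') (int k') (y + of_int l)) =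
    (if l = 0 then if j = j' \<and> k = k' then 1 else 0 else 0)"
    by auto
qed

section \<open>Orthogonality of scaling functions to wavelets of the same or a finer level\<close>

lemma multiresolution_scale:
  assumes "multiresolution_analysis V \<phi>"
  shows "f \<in> V j \<longleftrightarrow> (\<lambda>x. f (2 * x)) \<in> V (j + 1)"
  using assms unfolding multiresolution_analysis_def by (elim conjE) (erule allE, erule allE)

lemma multiresolution_dilate:
  assumes mra: "multiresolution_analysis V \<phi>" and f: "f \<in> V 0"
  shows "(\<lambda>x. f (2 ^ m * x)) \<in> V (int m)"
proof (induction m)
  case (Suc m)
  then have "(\<lambda>x. (\<lambda>x. f (2 ^ m * x)) (2 * x)) \<in> V (int m + 1)"
    by (rule multiresolution_scale[OF mra, THEN iffD1])
  then show ?case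
    by (simp add: mult_ac add.commute)
qed (simp add: f)

lemma multiresolution_contract:
  assumes mra: "multiresolution_analysis V \<phi>" and f: "f \<in> V (int m)"
  shows "(\<lambda>x. f (x / 2 ^ m)) \<in> V 0"
  using f
proof (induction m arbitrary: f)
  case (Suc m)
  have "(\<lambda>x. (\<lambda>x. f (x / 2)) (2 * x)) \<in> V (int m + 1)"
    using Suc.prems by (simp add: add.commute)
  then have "(\<lambda>x. f (x / 2)) \<in> V (int m)"
    by (rule multiresolution_scale[OF mra, THEN iffD2])
  from Suc.IH[OF this] show ?case
    by (simp add: mult.commute)
qed simp

lemma multiresolution_mono:
  assumes mra: "multiresolution_analysis V \<phi>"
  shows "V (int m) \<subseteq> V (int (m + d))"
proof (induction d)
  case (Suc d)
  have "V (int (m + d)) \<subseteq> V (int (m + d) + 1)"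
    using mra unfolding multiresolution_analysis_def by blast
  with Suc show ?case
    by (simp add: add_ac)
qed simp

text \<open>Orthogonality is given at level 0 only. The substitution x = y / 2^j brings the wavelet
  there and takes the scaling function, an element of \<open>V (int m)\<close> and hence of
  \<open>V (int j)\<close>, into \<open>V 0\<close>.\<close>

lemma dilate_shift_scaling_wavelet_orthogonal:
  assumes mra: "multiresolution_analysis V \<phi>"
    and wav: "L2_orthonormal_basis lborel {f \<in> V 1. \<forall>h\<in>V 0. L2_inner lborel f h = 0}
      (\<lambda>(k::int) x. \<psi> (x - of_int k))"
    and "m \<le> j"
  shows "L2_inner lborel (dilate_shift \<phi> (int m) k) (dilate_shift \<psi> (int j) k') = 0"
proof -
  let ?f = "dilate_shift \<phi> (int m) k"
  have "(\<lambda>x. \<phi> (x - of_int k)) \<in> V 0"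
    using mra unfolding multiresolution_analysis_def L2_orthonormal_basis_def by blast
  then have "(\<lambda>x. \<phi> (2 ^ m * x - of_int k)) \<in> V (int m)"
    by (rule multiresolution_dilate[OF mra])
  then have "?f \<in> V (int m)"
    using mra unfolding multiresolution_analysis_def L2_closed_subspace_def dilate_shift_def
    by (simp add: powr_realpow)
  then have "?f \<in> V (int j)"
    using multiresolution_mono[OF mra, of m "j - m"] \<open>m \<le> j\<close> by auto
  then have h: "(\<lambda>x. ?f (x / 2 ^ j)) \<in> V 0"
    by (rule multiresolution_contract[OF mra])
  have "L2_inner lborel ?f (dilate_shift \<psi> (int j) k') =
      (LINT x|lborel. ?f x * (2 powr (real j / 2) * \<psi> (2 ^ j * x - of_int k')))"
    by (simp add: L2_inner_def dilate_shift_def[of \<psi>] powr_realpow)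
  also have "\<dots> = \<bar>1 / 2 ^ j\<bar> * (LINT y|lborel. ?f (y / 2 ^ j) * (2 powr (real j / 2) * \<psi> (y - of_int k')))"
    by (subst lborel_integral_real_affine[where c="1 / 2 ^ j" and t=0]) simp_all
  also have "\<dots> = \<bar>1 / 2 ^ j\<bar> * (2 powr (real j / 2) *
      L2_inner lborel (\<lambda>x. \<psi> (x - of_int k')) (\<lambda>x. ?f (x / 2 ^ j)))"
    unfolding L2_inner_def by (subst integral_mult_right_zero[symmetric]) (simp add: mult_ac)
  also have "L2_inner lborel (\<lambda>x. \<psi> (x - of_int k')) (\<lambda>x. ?f (x / 2 ^ j)) = 0"
    using wav h unfolding L2_orthonormal_basis_def by blast
  finally show ?thesis by simp
qed

lemma periodized_scaling_wavelet_orthogonal: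
  assumes \<phi>: "bump R \<phi>" and \<psi>: "bump R' \<psi>"
    and mra: "multiresolution_analysis V \<phi>"
    and wav: "L2_orthonormal_basis lborel {f \<in> V 1. \<forall>h\<in>V 0. L2_inner lborel f h = 0}
      (\<lambda>(k::int) x. \<psi> (x - of_int k))"
    and "m \<le> j"
  shows "L2_inner unit_lborel (periodized \<phi> m k) (periodized \<psi> j k') = 0"
  unfolding periodized_eq_periodization
  by (rule L2_inner_periodization[OF bump_dilate_shift[OF \<phi>] bump_dilate_shift[OF \<psi>]])
    (simp only: dilate_shift_add_int eta_contract_eq if_cancel
      dilate_shift_scaling_wavelet_orthogonal[OF mra wav \<open>m \<le> j\<close>])

text \<open>At most 2R + 3 integer translates contribute at \<open>x\<close>, whatever
  \<open>j\<close> is: a contributing one has \<open>x + i\<close> in [-R, R + 1], because 0 \<le> k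
  < 2^j. The bound therefore scales in \<open>j\<close> like that of a single dilated
  wavelet.\<close>

lemma abs_periodized_le:
  assumes \<psi>: "bump (real R) \<psi>" and C: "\<And>x. \<bar>\<psi> x\<bar> \<le> C"
    and "k < 2 ^ j" and x: "x \<in> {0..1}"
  shows "\<bar>periodized \<psi> j k x\<bar> \<le> real (2 * R + 3) * C * 2 powr (real j / 2)"
proof -
  let ?u = "\<lambda>i::int. dilate_shift \<psi> (int j) (int k) (x + of_int i)" and ?N = "int R + 1"
  have zero: "?u i = 0" if "i \<notin> {- ?N..?N}" for i
  proof (rule ccontr)
    assume "?u i \<noteq> 0"
    then have le: "\<bar>2 ^ j * (x + of_int i) - real k\<bar> \<le> R"
      using \<psi> by (auto simp: dilate_shift_def bump_def powr_realpow)
    have j: "real k < 2 ^ j" "real R \<le> 2 ^ j * real R"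
      using \<open>k < 2 ^ j\<close> by (simp_all add: mult_le_cancel_right1)
    have "2 ^ j * (x + of_int i) \<le> 2 ^ j * (real R + 1)"
      using le j unfolding distrib_left mult_1_right by linarith
    moreover have "2 ^ j * (x + of_int i) \<ge> 2 ^ j * (- real R)"
      using le j of_nat_0_le_iff[of k, where 'a=real] unfolding mult_minus_right by linarith
    ultimately have "x + of_int i \<le> real R + 1" "- real R \<le> x + of_int i"
      by (simp_all only: mult_le_cancel_left_pos[of "2 ^ j" for j] zero_less_power zero_less_numeral)
    with x have "of_int i \<le> real R + 1" "- real R - 1 \<le> of_int i"
      by auto
    then have "i \<le> ?N" "- ?N \<le> i"
      by linarith+
    with that show False by auto
  qed
  have "periodized \<psi> j k x = infsum ?u {- ?N..?N}"
    unfolding periodized_eq_periodization periodization_def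
    using zero by (intro infsum_cong_neutral) auto
  also have "\<dots> = sum ?u {- ?N..?N}"
    by simp
  finally have "\<bar>periodized \<psi> j k x\<bar> \<le> (\<Sum>i\<in>{- ?N..?N}. \<bar>?u i\<bar>)"
    by simp
  also have "\<dots> \<le> (\<Sum>i\<in>{- ?N..?N}. 2 powr (real j / 2) * C)"
    by (intro sum_mono) (auto simp: dilate_shift_def abs_mult intro!: mult_left_mono C)
  also have "\<dots> = real (2 * R + 3) * C * 2 powr (real j / 2)"
    by (simp add: nat_add_distrib nat_mult_distrib algebra_simps)
  finally show ?thesis .
qed

text \<open>With \<open>k\<close> more than \<open>R\<close> away from 0 and from 2^j, the support
  of the dilated wavelet lies strictly inside the unit interval, so only the translate i = 0 reaches
  [0,1] and nothing wraps around.\<close>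

lemma periodized_support:
  assumes \<psi>: "bump (real R) \<psi>" and k: "R < k" "k + R < 2 ^ j"
    and x: "x \<in> {0..1}" and nz: "periodized \<psi> j k x \<noteq> 0"
  shows "\<bar>2 ^ j * x - real k\<bar> \<le> real R"
proof -
  obtain i :: int where "dilate_shift \<psi> (int j) (int k) (x + of_int i) \<noteq> 0"
    using nz unfolding periodized_eq_periodization periodization_def by (metis infsum_0)
  then have le: "\<bar>2 ^ j * (x + of_int i) - real k\<bar> \<le> real R"
    using \<psi> by (auto simp: dilate_shift_def bump_def powr_realpow)
  have "real R < real k"
    using k by simp
  moreover have "real (k + R) < 2 ^ j"
    using k by (simp only: of_nat_less_numeral_power_cancel_iff)
  ultimately have "real R < real k" "real k + real R < 2 ^ j"
    by simp_all
  then have "2 ^ j * 0 < 2 ^ j * (x + of_int i)" "2 ^ j * (x + of_int i) < 2 ^ j * 1"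
    using le unfolding mult_zero_right mult_1_right by linarith+
  then have "0 < x + of_int i" "x + of_int i < 1"
    by (simp_all only: mult_less_cancel_left_pos[of "2 ^ j" for j] zero_less_power zero_less_numeral)
  then have "i = 0"
    using x by auto
  with le show ?thesis by simp
qed

lemma periodized_measurable:
  assumes "bump R \<psi>"
  shows "periodized \<psi> j k \<in> borel_measurable unit_lborel"
  unfolding periodized_eq_periodization by (rule periodization_measurable[OF bump_dilate_shift[OF assms]])


section \<open>Perturbations in the Besov ball\<close>

lemma ennreal_ge_1_cases:
  assumes "1 \<le> (p::ennreal)"
  obtains "p = \<infinity>" | P where "p = ennreal P" "1 \<le> P"
proof (cases p)
  case (real P)
  then have "1 \<le> P"
    using assms by simp
  with real that(2) show ?thesis by blast
qed (use that(1) in simp)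

lemma enn2real_one_divide_ennreal: "1 \<le> P \<Longrightarrow> enn2real (1 / ennreal P) = 1 / P"
  by (simp add: divide_ennreal flip: ennreal_1)

lemma ennreal_powr_ennreal: "0 \<le> x \<Longrightarrow> ennreal_powr (ennreal x) a = ennreal (x powr a)"
  by (simp add: ennreal_powr_def)

lemma lp_norm_cong:
  assumes "\<And>i. i \<in> I \<Longrightarrow> a i = b i"
  shows "lp_norm p I a = lp_norm p I b"
proof -
  have "(SUP i\<in>I. a i) = (SUP i\<in>I. b i)"
    using assms by (rule SUP_cong[OF refl])
  moreover have "(\<Sum>\<^sub>\<infinity>i\<in>I. ennreal_powr (a i) t) = (\<Sum>\<^sub>\<infinity>i\<in>I. ennreal_powr (b i) t)" for t
    using assms by (intro infsum_cong) simp
  ultimately show ?thesis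
    by (simp add: lp_norm_def)
qed

lemma lp_norm_zero: "1 \<le> p \<Longrightarrow> lp_norm p I (\<lambda>i. 0) = 0"
  unfolding lp_norm_def ennreal_powr_def by (cases "I = {}") (auto simp: bot_ennreal)

text \<open>A sequence living on one level has the same norm for every \<open>q\<close>, which is
  why \<open>q\<close> does not appear in the rates.\<close>

lemma lp_norm_single:
  assumes "1 \<le> q" "j \<in> J" "0 \<le> c"
  shows "lp_norm q J (\<lambda>i. if i = j then ennreal c else 0) = ennreal c"
proof (cases rule: ennreal_ge_1_cases[OF \<open>1 \<le> q\<close>])
  case 1
  have "(SUP i\<in>J. if i = j then ennreal c else 0) = ennreal c"
    by (intro antisym SUP_least SUP_upper2[OF \<open>j \<in> J\<close>]) auto
  then show ?thesis
    by (simp add: lp_norm_def 1)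
next
  case (2 Q)
  have "(\<Sum>\<^sub>\<infinity>i\<in>J. ennreal_powr (if i = j then ennreal c else 0) Q) =
      (\<Sum>\<^sub>\<infinity>i\<in>{j}. ennreal (c powr Q))"
    using assms 2 by (intro infsum_cong_neutral) (auto simp: ennreal_powr_def)
  then show ?thesis
    using 2 assms by (simp add: lp_norm_def ennreal_powr_ennreal powr_powr)
qed

text \<open>The bound uses \<open>card K\<close> for every subset \<open>S\<close>, so that a single
  condition on \<open>c\<close> puts all vertices of the cube into the ball.\<close>

lemma lp_norm_indicator_le:
  assumes p: "1 \<le> p" and S: "S \<subseteq> K" "K \<noteq> {}" "finite K" "K \<subseteq> I" and c: "0 \<le> c"
  shows "lp_norm p I (\<lambda>k. ennreal \<bar>if k \<in> S then c else 0\<bar>) \<le>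
    ennreal (c * real (card K) powr enn2real (1 / p))"
proof (cases rule: ennreal_ge_1_cases[OF p])
  case 1
  have "(SUP k\<in>I. ennreal \<bar>if k \<in> S then c else 0\<bar>) \<le> ennreal c"
    using c by (intro SUP_least) auto
  \<comment> \<open>The exponent 1/p is 0 here, and \<open>card K powr 0 = 1\<close> relies on
    \<open>K\<close> being nonempty because \<open>0 powr 0 = 0\<close>.\<close>
  then show ?thesis
    using S by (simp add: lp_norm_def 1 card_gt_0_iff)
next
  case (2 P)
  have fin: "finite S"
    using S finite_subset by blast
  have "(\<Sum>\<^sub>\<infinity>k\<in>I. ennreal_powr (ennreal \<bar>if k \<in> S then c else 0\<bar>) P) =
      (\<Sum>\<^sub>\<infinity>k\<in>S. ennreal (c powr P))"
    using S c 2 by (intro infsum_cong_neutral) (auto simp: ennreal_powr_def)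
  also have "\<dots> = ennreal (real (card S) * c powr P)"
    using fin by (simp add: ennreal_mult' ennreal_of_nat_eq_real_of_nat)
  finally have "lp_norm p I (\<lambda>k. ennreal \<bar>if k \<in> S then c else 0\<bar>) =
      ennreal ((real (card S) * c powr P) powr (1 / P))"
    using 2 by (simp add: lp_norm_def ennreal_powr_ennreal)
  also have "(real (card S) * c powr P) powr (1 / P) = c * real (card S) powr (1 / P)"
    using 2 c by (simp add: powr_mult powr_powr)
  also have "\<dots> \<le> c * real (card K) powr (1 / P)"
    using 2 c S by (intro mult_left_mono powr_mono2) (auto simp: card_mono)
  finally show ?thesis
    using 2 by (simp add: enn2real_one_divide_ennreal ennreal_leI)
qed

lemma bounded_in_Lp_unit:
  assumes [measurable]: "f \<in> borel_measurable unit_lborel"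
    and bd: "\<And>x. x \<in> {0..1} \<Longrightarrow> \<bar>f x\<bar> \<le> c" and p: "1 \<le> p"
  shows "f \<in> Lp_unit p"
proof -
  have fin: "emeasure unit_lborel (space unit_lborel) < \<infinity>"
    by (simp add: unit_lborel_def emeasure_restrict_space space_restrict_space)
  have "\<exists>c. AE x in unit_lborel. \<bar>f x\<bar> \<le> c"
    by (intro exI[of _ c] AE_I2) (simp add: bd)
  moreover have "integrable unit_lborel (\<lambda>x. \<bar>f x\<bar> powr enn2real p)"
  proof (rule integrableI_bounded_set[where A="space unit_lborel" and B="c powr enn2real p"])
    show "AE x\<in>space unit_lborel in unit_lborel. norm (\<bar>f x\<bar> powr enn2real p) \<le> c powr enn2real p"
      by (intro AE_I2) (auto intro!: powr_mono2 bd)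
  qed (use fin sets.top[of unit_lborel] in auto)
  ultimately show ?thesis
    by (simp add: Lp_unit_def)
qed

lemma bounded_in_L2_unit:
  assumes "f \<in> borel_measurable unit_lborel" "\<And>x. x \<in> {0..1} \<Longrightarrow> \<bar>f x\<bar> \<le> c"
  shows "f \<in> L2 unit_lborel"
  using bounded_in_Lp_unit[OF assms, of 2] assms(1)
  by (simp add: Lp_unit_def L2_def powr_numeral split: if_splits)

text \<open>As exp u \<le> 1 + 2u on [0,1] and both \<open>g\<close> and \<open>e\<^sup>2\<close>
  have integral one, a single factor is at most 1 + 2 c^2 G. Its \<open>n\<close>-th power is at
  most exp (2 n c^2 G) \<le> exp (1/2) \<le> 2, whence the 1/4. \<open>G\<close> bounds
  \<open>g\<close> only where \<open>e\<close> does not vanish, so an \<open>e\<close> localized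
  near the zero of \<open>g\<close> admits a small \<open>G\<close>.\<close>

lemma second_moment_le_2:
  assumes g: "probability_density_on_unit g" and e: "e \<in> L2 unit_lborel" "L2_inner unit_lborel e e = 1"
    and le1: "\<And>x. x \<in> {0..1} \<Longrightarrow> (c * e x)\<^sup>2 \<le> 1"
    and G: "\<And>x. x \<in> {0..1} \<Longrightarrow> e x \<noteq> 0 \<Longrightarrow> g x \<le> G" "0 \<le> G" and n: "real n * c\<^sup>2 * G \<le> 1 / 4"
  shows "(\<integral>\<^sup>+x. ennreal (g x * exp ((c * e x)\<^sup>2)) \<partial>unit_lborel) ^ n \<le> 2"
proof -
  have [measurable]: "g \<in> borel_measurable unit_lborel" "e \<in> borel_measurable unit_lborel"
    using g e by (auto simp: probability_density_on_unit_def L2_def)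
  define \<epsilon> where "\<epsilon> = 2 * c\<^sup>2 * G"
  have \<epsilon>: "0 \<le> \<epsilon>"
    using G(2) by (simp add: \<epsilon>_def)
  have pw: "g x * exp ((c * e x)\<^sup>2) \<le> g x + \<epsilon> * (e x)\<^sup>2" if x: "x \<in> {0..1}" for x
  proof (cases "e x = 0")
    case False
    let ?u = "(c * e x)\<^sup>2"
    have g0: "0 \<le> g x"
      using g x by (simp add: probability_density_on_unit_def)
    have "exp u \<le> 1 + 2 * u" if "0 \<le> u" "u \<le> 1" for u :: real
      using exp_bound[OF that] mult_left_le[OF that(2,1)] by (simp add: power2_eq_square)
    then have "exp ?u \<le> 1 + 2 * ?u"
      using le1[OF x] by simp
    then have "g x * exp ?u \<le> g x * (1 + 2 * ?u)"
      using g0 by (rule mult_left_mono)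
    also have "\<dots> \<le> g x + G * (2 * ?u)"
      using G(1)[OF x False] by (simp add: distrib_left mult_right_mono)
    finally show ?thesis
      by (simp add: \<epsilon>_def power_mult_distrib mult_ac)
  qed simp
  have "(\<integral>\<^sup>+x. ennreal (g x * exp ((c * e x)\<^sup>2)) \<partial>unit_lborel) \<le>
      (\<integral>\<^sup>+x. ennreal (g x) + ennreal \<epsilon> * ennreal ((e x)\<^sup>2) \<partial>unit_lborel)"
    using pw g \<epsilon> by (intro nn_integral_mono)
      (auto simp: probability_density_on_unit_def intro!: ennreal_leI simp flip: ennreal_plus ennreal_mult')
  also have "\<dots> = (\<integral>\<^sup>+x. ennreal (g x) \<partial>unit_lborel) + ennreal \<epsilon> * (\<integral>\<^sup>+x. ennreal ((e x)\<^sup>2) \<partial>unit_lborel)"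
    by (simp add: nn_integral_add nn_integral_cmult)
  also have "(\<integral>\<^sup>+x. ennreal ((e x)\<^sup>2) \<partial>unit_lborel) = 1"
    using e by (subst nn_integral_eq_integral) (auto simp: L2_def L2_inner_def power2_eq_square)
  also have "(\<integral>\<^sup>+x. ennreal (g x) \<partial>unit_lborel) = 1"
    using g by (simp add: probability_density_on_unit_def)
  also have "1 + ennreal \<epsilon> * 1 = ennreal (1 + \<epsilon>)"
    using \<epsilon> by simp
  finally have "(\<integral>\<^sup>+x. ennreal (g x * exp ((c * e x)\<^sup>2)) \<partial>unit_lborel) ^ n \<le> ennreal (1 + \<epsilon>) ^ n"
    by (intro power_mono) auto
  also have "\<dots> = ennreal ((1 + \<epsilon>) ^ n)"
    using \<epsilon> by (intro ennreal_power) simp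
  also have "(1 + \<epsilon>) ^ n \<le> exp \<epsilon> ^ n"
    using \<epsilon> by (intro power_mono) auto
  also have "exp \<epsilon> ^ n = exp (real n * \<epsilon>)"
    by (rule exp_of_nat_mult[symmetric])
  also have "\<dots> \<le> exp (1 / 2)"
    using n by (simp add: \<epsilon>_def mult_ac)
  also have "\<dots> \<le> 2"
    by (rule exp_half_le2)
  finally show ?thesis
    by (simp add: ennreal_leI)
qed

lemma bump_from_regular:
  assumes "r_regular r h" "h \<in> borel_measurable borel" "supp h = {of_int L..of_int U}"
  shows "bump (real (nat (max \<bar>L\<bar> \<bar>U\<bar>))) h"
proof -
  obtain Dh :: "nat \<Rightarrow> real \<Rightarrow> real" where "Dh 0 = h" "\<forall>i\<le>r. \<forall>N::nat. \<exists>C. \<forall>x. \<bar>Dh i x\<bar> \<le> C / (1 + \<bar>x\<bar>) ^ N"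
    using assms(1) by (auto simp: r_regular_def)
  \<comment> \<open>Decay of order zero is plain boundedness.\<close>
  then obtain C where "\<And>x. \<bar>h x\<bar> \<le> C / (1 + \<bar>x\<bar>) ^ 0"
    by (metis le0)
  then have "\<exists>C. \<forall>x. \<bar>h x\<bar> \<le> C"
    by auto
  moreover have "\<bar>x\<bar> \<le> real (nat (max \<bar>L\<bar> \<bar>U\<bar>))" if "h x \<noteq> 0" for x
  proof -
    have "x \<in> supp h"
      unfolding supp_def using that by (intro subsetD[OF closure_subset]) simp
    then show ?thesis
      using assms(3) by (simp add: abs_le_iff) linarith
  qed
  ultimately show ?thesis
    using assms(2) by (simp add: bump_def)
qed

text \<open>By orthogonality all coefficients of the sum are explicit: zero on the coarse part and
  off level \<open>j\<close>, and \<open>c\<close> or 0 on level \<open>j\<close>. The Besov norm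
  reduces to one weighted sequence norm.\<close>

lemma level_combination_in_besov_ball:
  assumes \<phi>: "bump R \<phi>" and \<psi>: "bump R' \<psi>"
    and mra: "multiresolution_analysis V \<phi>"
    and wav: "L2_orthonormal_basis lborel {f \<in> V 1. \<forall>h\<in>V 0. L2_inner lborel f h = 0}
      (\<lambda>(k::int) x. \<psi> (x - of_int k))"
    and basis: "L2_orthonormal_basis lborel (L2 lborel) (\<lambda>(j, k). dilate_shift \<psi> j k)"
    and L2\<psi>: "\<And>j k. k < 2 ^ j \<Longrightarrow> periodized \<psi> j k \<in> L2 unit_lborel"
    and L2\<phi>: "\<And>j k. k < 2 ^ j \<Longrightarrow> periodized \<phi> j k \<in> L2 unit_lborel"
    and bd: "\<And>k x. k < 2 ^ j \<Longrightarrow> x \<in> {0..1} \<Longrightarrow> \<bar>periodized \<psi> j k x\<bar> \<le> E"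
    and p: "1 \<le> p" and q: "1 \<le> q" and mj: "m \<le> j"
    and S: "S \<subseteq> K" and K: "K \<subseteq> {..<2 ^ j}" "K \<noteq> {}" and c: "0 \<le> c"
    and A: "2 powr (real j * s_prime s p) * (c * real (card K) powr enn2real (1 / p)) \<le> A"
  shows "(\<lambda>x. \<Sum>k\<in>S. c * periodized \<psi> j k x) \<in> besov_ball \<phi> \<psi> m s p q A"
proof -
  let ?f = "\<lambda>x. \<Sum>k\<in>S. c * periodized \<psi> j k x"
  let ?K = "{..<2 ^ j} :: nat set"
  have SK: "S \<subseteq> ?K" "finite K"
    using S K finite_subset by blast+
  have e: "periodized \<psi> j k \<in> L2 unit_lborel" if "k \<in> S" for k
    using L2\<psi> SK that by blast
  have inner: "L2_inner unit_lborel ?f w = (\<Sum>k\<in>S. c * L2_inner unit_lborel (periodized \<psi> j k) w)"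
    if "w \<in> L2 unit_lborel" for w
    using that e by (subst L2_inner_sum_left) (auto simp: L2_cmult L2_inner_cmult_left)
  have scaling: "L2_inner unit_lborel ?f (periodized \<phi> m k) = 0" if "k \<in> {..<2 ^ m}" for k
    using that L2\<phi> by (subst inner)
      (auto simp: L2_inner_commute[of _ "periodized \<psi> _ _"]
        periodized_scaling_wavelet_orthogonal[OF \<phi> \<psi> mra wav mj])
  have wavelet: "L2_inner unit_lborel ?f (periodized \<psi> i l) = (if i = j \<and> l \<in> S then c else 0)"
    if "l < 2 ^ i" for i l
  proof -
    have "L2_inner unit_lborel ?f (periodized \<psi> i l) = (\<Sum>k\<in>S. if k = l then if j = i then c else 0 else 0)"
      using SK that by (subst inner[OF L2\<psi>])
        (auto intro!: sum.cong simp: periodized_wavelets_orthonormal[OF \<psi> basis] subset_eq)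
    also have "\<dots> = (if i = j \<and> l \<in> S then c else 0)"
      using finite_subset[OF SK(1)] by auto
    finally show ?thesis .
  qed
  have norm0: "lp_norm p {..<2 ^ m} (\<lambda>k. ennreal \<bar>L2_inner unit_lborel ?f (periodized \<phi> m k)\<bar>) = 0"
    by (subst lp_norm_cong[where b="\<lambda>_. 0"]) (simp_all only: scaling abs_zero ennreal_0 lp_norm_zero[OF p])
  define N where "N i = ennreal (2 powr (real i * s_prime s p)) *
    lp_norm p {..<2 ^ i} (\<lambda>k. ennreal \<bar>L2_inner unit_lborel ?f (periodized \<psi> i k)\<bar>)" for i
  have N0: "N i = 0" if "i \<noteq> j" for i
  proof -
    have "lp_norm p {..<2 ^ i} (\<lambda>k. ennreal \<bar>L2_inner unit_lborel ?f (periodized \<psi> i k)\<bar>) = 0"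
      using that by (subst lp_norm_cong[where b="\<lambda>_. 0"]) (simp_all add: wavelet lp_norm_zero[OF p])
    then show ?thesis
      by (simp add: N_def)
  qed
  have "lp_norm p ?K (\<lambda>k. ennreal \<bar>L2_inner unit_lborel ?f (periodized \<psi> j k)\<bar>) =
      lp_norm p ?K (\<lambda>k. ennreal \<bar>if k \<in> S then c else 0\<bar>)"
    by (rule lp_norm_cong) (simp add: wavelet)
  also have "\<dots> \<le> ennreal (c * real (card K) powr enn2real (1 / p))"
    using S K SK by (intro lp_norm_indicator_le p c) auto
  finally have "N j \<le> ennreal (2 powr (real j * s_prime s p)) * ennreal (c * real (card K) powr enn2real (1 / p))"
    unfolding N_def by (rule mult_left_mono) simp
  also have "\<dots> \<le> ennreal A"
    using A c by (simp add: ennreal_leI flip: ennreal_mult')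
  finally have "N j \<le> ennreal A" .
  \<comment> \<open>Finiteness of the level-\<open>j\<close> term brings it into the real form
    treated by \<open>lp_norm_single\<close>.\<close>
  then obtain a where a: "N j = ennreal a" "0 \<le> a"
    by (metis ennreal_cases ennreal_less_top leD top.not_eq_extremum)
  have "N = (\<lambda>i. if i = j then ennreal a else 0)"
    using N0 a by auto
  then have "lp_norm q {m..} N = N j"
    using lp_norm_single[OF q, of j "{m..}" a] a mj by simp
  moreover have "?f \<in> Lp_unit p"
  proof (rule bounded_in_Lp_unit[OF _ _ p])
    show "?f \<in> borel_measurable unit_lborel"
      using e by (intro borel_measurable_sum borel_measurable_times) (auto simp: L2_def)
    show "\<bar>?f x\<bar> \<le> (\<Sum>k\<in>S. c * E)" if "x \<in> {0..1}" for x
    proof (rule order_trans[OF sum_abs sum_mono])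
      fix k assume "k \<in> S"
      then show "\<bar>c * periodized \<psi> j k x\<bar> \<le> c * E"
        using SK bd[OF _ that] c by (auto simp: abs_mult intro!: mult_left_mono)
    qed
  qed
  ultimately show ?thesis
    using norm0 \<open>N j \<le> ennreal A\<close> unfolding besov_ball_def N_def by simp
qed

text \<open>The facts about wavelets are condensed into \<open>R\<close>, the radius of
  localization, and \<open>E\<close>, for which the square of \<open>periodized \<psi> j k\<close>
  is at most \<open>E * 2 ^ j\<close>. What remains is to choose \<open>j\<close>, \<open>K\<close>
  and \<open>c\<close> under three constraints: linearization, membership in the ball,
  undetectability.\<close>

lemma wavelet_minimax_bound:
  fixes p q :: ennreal
  assumes pair: "regular_wavelet_pair r \<phi> \<psi>"
    and supp: "supp \<phi> = {of_int L\<^sub>\<phi>..of_int U\<^sub>\<phi>}" "supp \<psi> = {of_int L\<^sub>\<psi>..of_int U\<^sub>\<psi>}"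
    and g: "probability_density_on_unit g" and p: "1 \<le> p" and q: "1 \<le> q"
  obtains R :: nat and E :: real where "0 < E"
    "\<And>j k x. R < k \<Longrightarrow> k + R < 2 ^ j \<Longrightarrow> x \<in> {0..1} \<Longrightarrow> periodized \<psi> j k x \<noteq> 0 \<Longrightarrow>
      \<bar>2 ^ j * x - real k\<bar> \<le> real R"
    "\<And>n m j K c G s A. m \<le> j \<Longrightarrow> K \<subseteq> {..<2 ^ j} \<Longrightarrow> K \<noteq> {} \<Longrightarrow> 0 \<le> c \<Longrightarrow> c\<^sup>2 * 2 ^ j * E \<le> 1 \<Longrightarrow>
      2 powr (real j * s_prime s p) * (c * real (card K) powr enn2real (1 / p)) \<le> A \<Longrightarrow>
      0 \<le> G \<Longrightarrow> real n * c\<^sup>2 * G \<le> 1 / 4 \<Longrightarrow>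
      (\<And>k x. k \<in> K \<Longrightarrow> x \<in> {0..1} \<Longrightarrow> periodized \<psi> j k x \<noteq> 0 \<Longrightarrow> g x \<le> G) \<Longrightarrow>
      ennreal (real (card K) * c\<^sup>2 / 8) \<le> minimax_risk g n (besov_ball \<phi> \<psi> m s p q A)"
proof -
  obtain V where mra: "multiresolution_analysis V \<phi>" and reg: "r_regular r \<phi>" "r_regular r \<psi>"
    and wav: "L2_orthonormal_basis lborel {f \<in> V 1. \<forall>h\<in>V 0. L2_inner lborel f h = 0}
      (\<lambda>(k::int) x. \<psi> (x - of_int k))"
    and basis: "L2_orthonormal_basis lborel (L2 lborel) (\<lambda>(j, k). dilate_shift \<psi> j k)"
    using pair unfolding regular_wavelet_pair_def by blast
  have VL2: "V j \<subseteq> L2 lborel" for j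
    using mra by (simp add: multiresolution_analysis_def L2_closed_subspace_def)
  have "L2_orthonormal_basis lborel (V 0) (\<lambda>(k::int) x. \<phi> (x - of_int k))"
    using mra by (simp add: multiresolution_analysis_def)
  then have "(\<lambda>x. \<phi> (x - of_int k)) \<in> V 0" "(\<lambda>x. \<psi> (x - of_int k)) \<in> V 1" for k
    using wav by (simp_all add: L2_orthonormal_basis_def)
  \<comment> \<open>The untranslated members of the two bases give measurability, since each
    \<open>V j\<close> consists of Borel functions.\<close>
  from this[of 0] have m: "\<phi> \<in> borel_measurable borel" "\<psi> \<in> borel_measurable borel"
    using VL2 by (auto simp: L2_def)
  define R\<^sub>\<phi> where "R\<^sub>\<phi> = nat (max \<bar>L\<^sub>\<phi>\<bar> \<bar>U\<^sub>\<phi>\<bar>)"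
  define R where "R = nat (max \<bar>L\<^sub>\<psi>\<bar> \<bar>U\<^sub>\<psi>\<bar>)"
  have \<phi>: "bump (real R\<^sub>\<phi>) \<phi>" and \<psi>: "bump (real R) \<psi>"
    unfolding R\<^sub>\<phi>_def R_def by (rule bump_from_regular[OF reg(1) m(1) supp(1)] bump_from_regular[OF reg(2) m(2) supp(2)])+
  obtain C\<^sub>\<phi> C where C: "\<And>x. \<bar>\<phi> x\<bar> \<le> C\<^sub>\<phi>" "\<And>x. \<bar>\<psi> x\<bar> \<le> C"
    using \<phi> \<psi> by (auto simp: bump_def)
  define E0 where "E0 = real (2 * R + 3) * \<bar>C\<bar>"
  have bd: "\<bar>periodized \<psi> j k x\<bar> \<le> E0 * 2 powr (real j / 2)" if "k < 2 ^ j" "x \<in> {0..1}" for j k x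
    unfolding E0_def
    by (rule abs_periodized_le[OF \<psi> order_trans[OF C(2) abs_ge_self] that])
  have L2\<psi>: "periodized \<psi> j k \<in> L2 unit_lborel" if "k < 2 ^ j" for j k
    by (rule bounded_in_L2_unit[OF periodized_measurable[OF \<psi>] bd[OF that]])
  have L2\<phi>: "periodized \<phi> j k \<in> L2 unit_lborel" if "k < 2 ^ j" for j k
    by (rule bounded_in_L2_unit[OF periodized_measurable[OF \<phi>] abs_periodized_le[OF \<phi> C(1) that]])
  show ?thesis
  \<comment> \<open>Adding 1 makes the constant positive without a lower bound for
    \<open>C\<close>.\<close>
  proof (rule that[of "E0\<^sup>2 + 1" R])
    show "0 < E0\<^sup>2 + 1"
      by (simp add: add_nonneg_pos)
    show "\<bar>2 ^ j * x - real k\<bar> \<le> real R"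
      if "R < k" "k + R < 2 ^ j" "x \<in> {0..1}" "periodized \<psi> j k x \<noteq> 0" for j k x
      by (rule periodized_support[OF \<psi> that])
    fix n m j :: nat and K :: "nat set" and c G s A :: real
    assume mj: "m \<le> j" and K: "K \<subseteq> {..<2 ^ j}" "K \<noteq> {}" and c: "0 \<le> c" and cE: "c\<^sup>2 * 2 ^ j * (E0\<^sup>2 + 1) \<le> 1"
      and A: "2 powr (real j * s_prime s p) * (c * real (card K) powr enn2real (1 / p)) \<le> A"
      and G: "0 \<le> G" "real n * c\<^sup>2 * G \<le> 1 / 4"
      and gG: "\<And>k x. k \<in> K \<Longrightarrow> x \<in> {0..1} \<Longrightarrow> periodized \<psi> j k x \<noteq> 0 \<Longrightarrow> g x \<le> G"
    have le1: "(c * periodized \<psi> j k x)\<^sup>2 \<le> 1" if "k \<in> K" "x \<in> {0..1}" for k x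
    proof -
      have "\<bar>periodized \<psi> j k x\<bar>\<^sup>2 \<le> (E0 * 2 powr (real j / 2))\<^sup>2"
        using K that by (intro power_mono bd) auto
      also have "(2 powr (real j / 2))\<^sup>2 = (2::real) ^ j"
        by (simp add: powr_realpow flip: powr_numeral) (simp add: powr_powr powr_realpow)
      then have "(E0 * 2 powr (real j / 2))\<^sup>2 = E0\<^sup>2 * 2 ^ j"
        by (simp add: power_mult_distrib)
      also have "\<dots> \<le> (E0\<^sup>2 + 1) * 2 ^ j"
        by simp
      finally have "c\<^sup>2 * (periodized \<psi> j k x)\<^sup>2 \<le> c\<^sup>2 * ((E0\<^sup>2 + 1) * 2 ^ j)"
        by (intro mult_left_mono) simp_all
      then show ?thesis
        using cE by (simp add: power_mult_distrib mult_ac)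
    qed
    show "ennreal (real (card K) * c\<^sup>2 / 8) \<le> minimax_risk g n (besov_ball \<phi> \<psi> m s p q A)"
    proof (rule minimax_risk_hypercube[where e="periodized \<psi> j" and K=K])
      show "finite K"
        using K finite_subset by blast
      show on: "L2_inner unit_lborel (periodized \<psi> j k) (periodized \<psi> j l) = (if k = l then 1 else 0)"
        if "k \<in> K" "l \<in> K" for k l
        using K that by (subst periodized_wavelets_orthonormal[OF \<psi> basis]) auto
      show L2: "periodized \<psi> j k \<in> L2 unit_lborel" if "k \<in> K" for k
        using K that by (intro L2\<psi>) auto
      show "(\<lambda>x. \<Sum>k\<in>S. c * periodized \<psi> j k x) \<in> besov_ball \<phi> \<psi> m s p q A" if "S \<subseteq> K" for S
        by (rule level_combination_in_besov_ball[OF \<phi> \<psi> mra wav basis L2\<psi> L2\<phi> bd p q mj that K c A])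
      show "(\<integral>\<^sup>+x. ennreal (g x * exp ((c * periodized \<psi> j k x)\<^sup>2)) \<partial>unit_lborel) ^ n \<le> 2" if "k \<in> K" for k
        using that G by (intro second_moment_le_2[OF g L2 _ le1 gG]) (auto simp: on)
    qed (rule g)
  qed
qed


section \<open>Choice of the level\<close>

lemma dyadic_between:
  fixes Y :: real
  assumes "1 \<le> Y"
  obtains j :: nat where "Y \<le> 2 ^ j" "2 ^ j \<le> 2 * Y"
proof -
  define j where "j = (LEAST j. Y \<le> 2 ^ j)"
  have "\<exists>j. Y \<le> 2 ^ j"
    using real_arch_pow[of 2 Y] by (auto intro: less_imp_le)
  then have le: "Y \<le> 2 ^ j"
    unfolding j_def by (rule LeastI_ex)
  have "2 ^ j \<le> 2 * Y"
  proof (cases j)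
    case (Suc i)
    then have "\<not> Y \<le> 2 ^ i"
      unfolding j_def by (intro not_less_Least) simp
    with Suc show ?thesis by simp
  qed (use assms in simp)
  with le show ?thesis
    using that by blast
qed

text \<open>Since a \<le> 1, the square of \<open>a\<close> is at most \<open>a\<close>. Taking for
  \<open>P\<close> a sum of nonnegative quantities settles several constraints with one
  amplitude.\<close>

lemma small_amplitude:
  fixes A P :: real
  assumes "0 < A" "0 \<le> P"
  obtains a where "0 < a" "a \<le> A" "a\<^sup>2 * P \<le> 1"
proof -
  define a where "a = min A (min 1 (1 / (P + 1)))"
  have "0 < 1 / (P + 1)"
    using assms by simp
  then have a: "0 < a" "a \<le> A" "a \<le> 1" "a \<le> 1 / (P + 1)"
    unfolding a_def using assms(1) by linarith+
  have "a\<^sup>2 \<le> a"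
    using a by (simp add: power2_eq_square mult_left_le)
  then have "a\<^sup>2 * P \<le> 1 / (P + 1) * P"
    using a assms by (intro mult_right_mono) auto
  also have "\<dots> \<le> 1"
    using assms by (simp add: field_simps)
  finally show ?thesis
    using a that by blast
qed

lemma powr_power2: "0 < x \<Longrightarrow> (x powr t)\<^sup>2 = x powr (2 * t)" for x t :: real
  by (simp add: powr_add[symmetric] power2_eq_square)

lemma powr_mult_self: "0 < x \<Longrightarrow> x powr t * x = x powr (t + 1)" for x t :: real
  by (simp add: powr_add)

lemma two_powr_mult: "2 powr (real j * t) = (2 ^ j) powr t"
  by (simp add: powr_powr flip: powr_realpow)

text \<open>With X = 2^j, the amplitude c = a X powr (-(s + 1/2)) places the full level in the ball:
  the exponents s', -(s + 1/2) and 1/p add up to 0. Undetectability is ensured by n \<le> X powr (2s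
  + 1), and X c^2 = a^2 X powr (-2s) is the resulting rate.\<close>

lemma dense_lower_bound:
  fixes p q :: ennreal
  assumes pair: "regular_wavelet_pair r \<phi> \<psi>"
    and supp: "supp \<phi> = {of_int L\<^sub>\<phi>..of_int U\<^sub>\<phi>}" "supp \<psi> = {of_int L\<^sub>\<psi>..of_int U\<^sub>\<psi>}"
    and g: "probability_density_on_unit g" and p: "1 \<le> p" and q: "1 \<le> q"
    and G: "\<And>x. x \<in> {0..1} \<Longrightarrow> g x \<le> G" "0 \<le> G" and s: "0 < s" and A: "0 < A"
  shows "\<exists>C>0. \<forall>\<^sub>F n in sequentially. ennreal (C * real n powr (- (2 * s / (2 * s + 1)))) \<le>
    minimax_risk g n (besov_ball \<phi> \<psi> m s p q A)"
proof -
  obtain R E where E: "0 < E" and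
    bound: "\<And>n m j K c G s A. m \<le> j \<Longrightarrow> K \<subseteq> {..<2 ^ j} \<Longrightarrow> K \<noteq> {} \<Longrightarrow> 0 \<le> c \<Longrightarrow> c\<^sup>2 * 2 ^ j * E \<le> 1 \<Longrightarrow>
      2 powr (real j * s_prime s p) * (c * real (card K) powr enn2real (1 / p)) \<le> A \<Longrightarrow>
      0 \<le> G \<Longrightarrow> real n * c\<^sup>2 * G \<le> 1 / 4 \<Longrightarrow>
      (\<And>k x. k \<in> K \<Longrightarrow> x \<in> {0..1} \<Longrightarrow> periodized \<psi> j k x \<noteq> 0 \<Longrightarrow> g x \<le> G) \<Longrightarrow>
      ennreal (real (card K) * c\<^sup>2 / 8) \<le> minimax_risk g n (besov_ball \<phi> \<psi> m s p q A)"
    by (rule wavelet_minimax_bound[OF pair supp g p q]) blast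
  obtain a where a: "0 < a" "a \<le> A" "a\<^sup>2 * (E + 4 * G) \<le> 1"
    by (rule small_amplitude[of A "E + 4 * G"]) (use A E G in auto)
  have "0 \<le> a\<^sup>2 * E" "0 \<le> a\<^sup>2 * G"
    using E G(2) by simp_all
  then have aE: "a\<^sup>2 * E \<le> 1" and aG: "a\<^sup>2 * G \<le> 1 / 4"
    using a(3) by (simp_all only: distrib_left)
  \<comment> \<open>The 1/8 comes from the hypercube bound, the power of 2 from rounding up to 2^j,
    which is at most 2 Y.\<close>
  define C where "C = a\<^sup>2 / 8 * 2 powr (- 2 * s)"
  have "filterlim (\<lambda>n. real n powr (1 / (2 * s + 1))) at_top sequentially"
    using s by (intro filterlim_compose[OF real_powr_at_top filterlim_real_sequentially]) simp
  then have "\<forall>\<^sub>F n in sequentially. 2 ^ m \<le> real n powr (1 / (2 * s + 1))"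
    by (simp add: filterlim_at_top)
  then have "\<forall>\<^sub>F n in sequentially. ennreal (C * real n powr (- (2 * s / (2 * s + 1)))) \<le>
    minimax_risk g n (besov_ball \<phi> \<psi> m s p q A)"
    using eventually_gt_at_top[of 0]
  proof eventually_elim
    case (elim n)
    define Y where "Y = real n powr (1 / (2 * s + 1))"
    have Y: "1 \<le> Y" "2 ^ m \<le> Y"
      using elim(1) one_le_power[of "2::real" m] unfolding Y_def by linarith+
    obtain j :: nat where j: "Y \<le> 2 ^ j" "2 ^ j \<le> 2 * Y"
      using dyadic_between[OF Y(1)] .
    define X :: real where "X = 2 ^ j"
    have X: "1 \<le> X" "0 < X" "Y \<le> X" "X \<le> 2 * Y"
      using j by (simp_all add: X_def)
    have "(2::real) ^ m \<le> 2 ^ j"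
      using Y j by linarith
    then have mj: "m \<le> j"
      by (rule power_le_imp_le_exp[rotated]) simp
    define c where "c = a * X powr (- (s + 1 / 2))"
    have c2: "c\<^sup>2 = a\<^sup>2 * X powr (- (2 * s + 1))"
    proof -
      have "2 * (- (s + 1 / 2)) = - (2 * s + 1)"
        by simp
      then show ?thesis
        by (simp only: c_def power_mult_distrib powr_power2[OF X(2)])
    qed
    have c2X: "c\<^sup>2 * X = a\<^sup>2 * X powr (- 2 * s)"
      using powr_mult_self[OF X(2), of "- (2 * s + 1)"] by (simp add: c2)
    have "ennreal (real (card {..<2 ^ j :: nat}) * c\<^sup>2 / 8) \<le> minimax_risk g n (besov_ball \<phi> \<psi> m s p q A)"
    proof (rule bound[OF mj])
      show "{..<2 ^ j :: nat} \<noteq> {}"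
        by (simp add: lessThan_empty_iff)
      show "0 \<le> c"
        using a by (simp add: c_def)
      have "X powr (- 2 * s) \<le> X powr 0"
        using X s by (intro powr_mono) auto
      then have "a\<^sup>2 * E * X powr (- 2 * s) \<le> 1 * 1"
        using X aE E by (intro mult_mono) auto
      then show "c\<^sup>2 * 2 ^ j * E \<le> 1"
        using c2X by (simp add: X_def mult_ac)
      have "2 powr (real j * s_prime s p) * (c * real (card {..<2 ^ j :: nat}) powr enn2real (1 / p)) =
          a * (X powr s_prime s p * X powr (- (s + 1 / 2)) * X powr enn2real (1 / p))"
        by (simp add: two_powr_mult X_def c_def mult_ac)
      also have "X powr s_prime s p * X powr (- (s + 1 / 2)) * X powr enn2real (1 / p) = 1"
        using X by (simp add: s_prime_def flip: powr_add)
      finally show "2 powr (real j * s_prime s p) * (c * real (card {..<2 ^ j :: nat}) powr enn2real (1 / p)) \<le> A"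
        using a by simp
      have "real n = Y powr (2 * s + 1)"
        using elim s by (simp add: Y_def powr_powr)
      also have "\<dots> \<le> X powr (2 * s + 1)"
        using X Y s by (intro powr_mono2) auto
      finally have "real n * X powr (- (2 * s + 1)) \<le> X powr (2 * s + 1) * X powr (- (2 * s + 1))"
        by (rule mult_right_mono) simp
      also have "\<dots> = 1"
        using X by (simp flip: powr_add)
      finally have "a\<^sup>2 * G * (real n * X powr (- (2 * s + 1))) \<le> a\<^sup>2 * G * 1"
        using G by (intro mult_left_mono) auto
      then show "real n * c\<^sup>2 * G \<le> 1 / 4"
        using aG by (simp add: c2 mult_ac)
    qed (use G in auto)
    also have "real (card {..<2 ^ j :: nat}) * c\<^sup>2 / 8 = a\<^sup>2 / 8 * X powr (- 2 * s)"
      using c2X by (simp add: X_def mult_ac)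
    finally have ub: "ennreal (a\<^sup>2 / 8 * X powr (- 2 * s)) \<le> minimax_risk g n (besov_ball \<phi> \<psi> m s p q A)" .
    have "C * real n powr (- (2 * s / (2 * s + 1))) = a\<^sup>2 / 8 * (2 * Y) powr (- 2 * s)"
      using Y s by (simp add: C_def Y_def powr_mult powr_powr)
    also have "\<dots> \<le> a\<^sup>2 / 8 * X powr (- 2 * s)"
      using X s by (intro mult_left_mono powr_mono2') auto
    finally show ?case
      using ub by (meson ennreal_leI order_trans)
  qed
  moreover have "0 < C"
    using a by (simp add: C_def)
  ultimately show ?thesis by blast
qed

text \<open>One statement for polynomial and exponential zeros: \<open>\<Gamma> X\<close> bounds
  \<open>g\<close> within distance \<open>\<rho> / X\<close> of \<open>x\<^sub>0\<close>, and
  \<open>Y n\<close> is the scale aimed at. The last premise keeps n c^2 \<Gamma>(X) bounded for c =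
  a X powr (-s').\<close>

lemma sparse_lower_bound:
  fixes p q :: ennreal
  assumes pair: "regular_wavelet_pair r \<phi> \<psi>"
    and supp: "supp \<phi> = {of_int L\<^sub>\<phi>..of_int U\<^sub>\<phi>}" "supp \<psi> = {of_int L\<^sub>\<psi>..of_int U\<^sub>\<psi>}"
    and g: "probability_density_on_unit g" and p: "1 \<le> p" and q: "1 \<le> q"
    and x\<^sub>0: "x\<^sub>0 \<in> {0..1}" and s': "1 / 2 \<le> s_prime s p" and A: "0 < A"
  obtains \<rho> :: real where "0 < \<rho>"
    "\<And>\<Gamma> Y M. filterlim Y at_top sequentially \<Longrightarrow>
      \<forall>\<^sub>F X in at_top. 0 \<le> \<Gamma> X \<and> (\<forall>x\<in>{0..1}. \<bar>x - x\<^sub>0\<bar> \<le> \<rho> / X \<longrightarrow> g x \<le> \<Gamma> X) \<Longrightarrow>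
      (\<And>n X. 0 < n \<Longrightarrow> 1 \<le> X \<Longrightarrow> 1 \<le> Y n \<Longrightarrow> Y n \<le> X \<Longrightarrow> real n * X powr (- 2 * s_prime s p) * \<Gamma> X \<le> M) \<Longrightarrow>
      \<exists>C>0. \<forall>\<^sub>F n in sequentially. ennreal (C * Y n powr (- 2 * s_prime s p)) \<le>
        minimax_risk g n (besov_ball \<phi> \<psi> m s p q A)"
proof -
  obtain R E where E: "0 < E" and
    local: "\<And>j k x. R < k \<Longrightarrow> k + R < 2 ^ j \<Longrightarrow> x \<in> {0..1} \<Longrightarrow> periodized \<psi> j k x \<noteq> 0 \<Longrightarrow>
      \<bar>2 ^ j * x - real k\<bar> \<le> real R" and
    bound: "\<And>n m j K c G s A. m \<le> j \<Longrightarrow> K \<subseteq> {..<2 ^ j} \<Longrightarrow> K \<noteq> {} \<Longrightarrow> 0 \<le> c \<Longrightarrow> c\<^sup>2 * 2 ^ j * E \<le> 1 \<Longrightarrow>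
      2 powr (real j * s_prime s p) * (c * real (card K) powr enn2real (1 / p)) \<le> A \<Longrightarrow>
      0 \<le> G \<Longrightarrow> real n * c\<^sup>2 * G \<le> 1 / 4 \<Longrightarrow>
      (\<And>k x. k \<in> K \<Longrightarrow> x \<in> {0..1} \<Longrightarrow> periodized \<psi> j k x \<noteq> 0 \<Longrightarrow> g x \<le> G) \<Longrightarrow>
      ennreal (real (card K) * c\<^sup>2 / 8) \<le> minimax_risk g n (besov_ball \<phi> \<psi> m s p q A)"
    by (rule wavelet_minimax_bound[OF pair supp g p q]) blast
  define \<sigma> where "\<sigma> = s_prime s p"
  show ?thesis
  \<comment> \<open>The support radius \<open>R\<close> plus a displacement of at most R + 1 stays
    below 2R + 3. Asking 2^j to be at least this number also guarantees an index without
    wrap-around.\<close>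
  proof (rule that[of "2 * real R + 3"])
    show "0 < 2 * real R + 3"
      by simp
    fix \<Gamma> :: "real \<Rightarrow> real" and Y :: "nat \<Rightarrow> real" and M :: real
    assume Y: "filterlim Y at_top sequentially"
      and \<Gamma>: "\<forall>\<^sub>F X in at_top. 0 \<le> \<Gamma> X \<and> (\<forall>x\<in>{0..1}. \<bar>x - x\<^sub>0\<bar> \<le> (2 * real R + 3) / X \<longrightarrow> g x \<le> \<Gamma> X)"
      and M: "\<And>n X. 0 < n \<Longrightarrow> 1 \<le> X \<Longrightarrow> 1 \<le> Y n \<Longrightarrow> Y n \<le> X \<Longrightarrow> real n * X powr (- 2 * s_prime s p) * \<Gamma> X \<le> M"
    obtain X0 where X0: "\<And>X x. X0 \<le> X \<Longrightarrow> 0 \<le> \<Gamma> X"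
      "\<And>X x. X0 \<le> X \<Longrightarrow> x \<in> {0..1} \<Longrightarrow> \<bar>x - x\<^sub>0\<bar> \<le> (2 * real R + 3) / X \<Longrightarrow> g x \<le> \<Gamma> X"
      using \<Gamma> unfolding eventually_at_top_linorder by blast
    obtain a where a: "0 < a" "a \<le> A" "a\<^sup>2 * (E + 4 * \<bar>M\<bar>) \<le> 1"
      by (rule small_amplitude[of A "E + 4 * \<bar>M\<bar>"]) (use A E in auto)
    have "0 \<le> a\<^sup>2 * E" "0 \<le> a\<^sup>2 * \<bar>M\<bar>"
      using E by simp_all
    then have aE: "a\<^sup>2 * E \<le> 1" and aM: "a\<^sup>2 * \<bar>M\<bar> \<le> 1 / 4"
      using a(3) by (simp_all only: distrib_left)
    define C where "C = a\<^sup>2 / 8 * 2 powr (- 2 * \<sigma>)"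
    have "\<forall>\<^sub>F n in sequentially. max (2 ^ m) (max X0 (2 * real R + 3)) \<le> Y n"
      using Y by (simp only: filterlim_at_top)
    then have "\<forall>\<^sub>F n in sequentially. ennreal (C * Y n powr (- 2 * \<sigma>)) \<le>
        minimax_risk g n (besov_ball \<phi> \<psi> m s p q A)"
      using eventually_gt_at_top[of 0]
    proof eventually_elim
      case (elim n)
      then have Yn: "2 ^ m \<le> Y n" "X0 \<le> Y n" "2 * real R + 3 \<le> Y n" "1 \<le> Y n" "0 < n"
        by auto
      obtain j :: nat where j: "Y n \<le> 2 ^ j" "2 ^ j \<le> 2 * Y n"
        using dyadic_between[OF Yn(4)] .
      define X :: real where "X = 2 ^ j"
      have X: "1 \<le> X" "0 < X" "Y n \<le> X" "X \<le> 2 * Y n" "X0 \<le> X"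
        using j Yn by (simp_all add: X_def)
      have "(2::real) ^ m \<le> 2 ^ j"
        using Yn j by linarith
      then have mj: "m \<le> j"
        by (rule power_le_imp_le_exp[rotated]) simp
      have "real (2 * R + 3) \<le> real (2 ^ j)"
        using Yn j by simp
      then have jR: "2 * R + 3 \<le> 2 ^ j"
        by (simp only: of_nat_le_iff)
      define l where "l = nat \<lfloor>X * x\<^sub>0\<rfloor>"
      have l: "real l \<le> X * x\<^sub>0" "X * x\<^sub>0 < real l + 1"
        using x\<^sub>0 X by (auto simp: l_def)
      \<comment> \<open>Clamping the dyadic cell \<open>l\<close> of \<open>x\<^sub>0\<close> to the
        indices without wrap-around covers zeros at or near an endpoint and moves the cell by at
        most R + 1.\<close>
      define k where "k = max (R + 1) (min l (2 ^ j - R - 1))"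
      have k: "R < k" "k + R < 2 ^ j"
        using jR by (auto simp: k_def)
      have kx: "\<bar>real k - X * x\<^sub>0\<bar> \<le> real R + 1"
      proof -
        have "X * x\<^sub>0 \<le> X * 1"
          using x\<^sub>0 X by (intro mult_left_mono) auto
        then have x0X: "0 \<le> X * x\<^sub>0" "X * x\<^sub>0 \<le> real (2 ^ j)"
          using x\<^sub>0 X by (auto simp: X_def)
        have "real (2 ^ j - R - 1) = real (2 ^ j) - real R - 1"
          using jR by (simp add: of_nat_diff)
        then show ?thesis
          using l x0X jR unfolding k_def of_nat_max of_nat_min of_nat_add by (auto simp: max_def min_def)
      qed
      define c where "c = a * X powr (- \<sigma>)"
      have c2: "c\<^sup>2 = a\<^sup>2 * X powr (- 2 * \<sigma>)"
        using X by (simp add: c_def power_mult_distrib powr_power2)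
      have "ennreal (real (card {k}) * c\<^sup>2 / 8) \<le> minimax_risk g n (besov_ball \<phi> \<psi> m s p q A)"
      proof (rule bound[OF mj])
        show "{k} \<subseteq> {..<2 ^ j}"
          using k by simp
        show "0 \<le> c"
          using a by (simp add: c_def)
        \<comment> \<open>Here s' \<ge> 1/2 enters: the exponent 1 - 2 s' is not positive, so
          \<open>c\<close> times the wavelet stays bounded.\<close>
        have "X powr (- 2 * \<sigma>) * X = X powr (1 - 2 * \<sigma>)"
          using powr_mult_self[OF X(2), of "- 2 * \<sigma>"] by simp
        also have "\<dots> \<le> X powr 0"
          using X s' by (intro powr_mono) (auto simp: \<sigma>_def)
        finally have "a\<^sup>2 * E * (X powr (- 2 * \<sigma>) * X) \<le> 1 * 1"
          using X aE E by (intro mult_mono) auto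
        then show "c\<^sup>2 * 2 ^ j * E \<le> 1"
          by (simp add: c2 mult_ac flip: X_def)
        have "2 powr (real j * s_prime s p) * (c * real (card {k}) powr enn2real (1 / p)) =
            a * (X powr \<sigma> * X powr (- \<sigma>))"
          by (simp add: two_powr_mult X_def c_def \<sigma>_def mult_ac)
        also have "X powr \<sigma> * X powr (- \<sigma>) = 1"
          using X by (simp flip: powr_add)
        finally show "2 powr (real j * s_prime s p) * (c * real (card {k}) powr enn2real (1 / p)) \<le> A"
          using a by simp
        show "0 \<le> \<Gamma> X"
          by (rule X0(1)[OF X(5)])
        have "real n * X powr (- 2 * \<sigma>) * \<Gamma> X \<le> \<bar>M\<bar>"
          using M[OF Yn(5) X(1) Yn(4) X(3)] by (simp add: \<sigma>_def)
        then have "a\<^sup>2 * (real n * X powr (- 2 * \<sigma>) * \<Gamma> X) \<le> a\<^sup>2 * \<bar>M\<bar>"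
          by (intro mult_left_mono) auto
        then show "real n * c\<^sup>2 * \<Gamma> X \<le> 1 / 4"
          using aM by (simp add: c2 mult_ac)
        show "g x \<le> \<Gamma> X" if "i \<in> {k}" "x \<in> {0..1}" "periodized \<psi> j i x \<noteq> 0" for i x
        proof (rule X0(2)[OF X(5) that(2)])
          have "\<bar>X * x - real k\<bar> \<le> real R"
            using local[OF k that(2)] that by (simp add: X_def)
          then have "\<bar>X * x - X * x\<^sub>0\<bar> \<le> 2 * real R + 3"
            using kx by linarith
          moreover have "\<bar>X * x - X * x\<^sub>0\<bar> = X * \<bar>x - x\<^sub>0\<bar>"
            using X by (simp add: abs_mult flip: right_diff_distrib)
          ultimately show "\<bar>x - x\<^sub>0\<bar> \<le> (2 * real R + 3) / X"
            using X by (simp add: field_simps)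
        qed
      qed simp
      then have ub: "ennreal (a\<^sup>2 / 8 * X powr (- 2 * \<sigma>)) \<le> minimax_risk g n (besov_ball \<phi> \<psi> m s p q A)"
        by (simp add: c2)
      have "C * Y n powr (- 2 * \<sigma>) = a\<^sup>2 / 8 * (2 * Y n) powr (- 2 * \<sigma>)"
        using Yn by (simp add: C_def powr_mult)
      also have "\<dots> \<le> a\<^sup>2 / 8 * X powr (- 2 * \<sigma>)"
        using X s' by (intro mult_left_mono powr_mono2') (auto simp: \<sigma>_def)
      finally show ?case
        using ub by (meson ennreal_leI order_trans)
    qed
    moreover have "0 < C"
      using a by (simp add: C_def)
    ultimately show "\<exists>C>0. \<forall>\<^sub>F n in sequentially. ennreal (C * Y n powr (- 2 * s_prime s p)) \<le>
        minimax_risk g n (besov_ball \<phi> \<psi> m s p q A)"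
      unfolding \<sigma>_def by blast
  qed
qed

text \<open>Close to \<open>x\<^sub>0\<close> the normalized density stays below
  \<open>C\<^sub>g + 1\<close>; multiplying by the inverse of the weight isolates
  \<open>g\<close>.\<close>

lemma assumption_A_upper_bound:
  assumes "assumption_A g x\<^sub>0 \<alpha> b \<beta> C\<^sub>g"
  obtains d where "0 < d" "\<And>x. x \<in> {0..1} \<Longrightarrow> \<bar>x - x\<^sub>0\<bar> < d \<Longrightarrow>
    g x \<le> (C\<^sub>g + 1) * (\<bar>x - x\<^sub>0\<bar> powr \<alpha> * exp (- (b * \<bar>x - x\<^sub>0\<bar> powr (- \<beta>))))"
proof -
  let ?S = "{x. x\<^sub>0 + x \<in> {0..1}}"
  let ?h = "\<lambda>x. g (x\<^sub>0 + x) * \<bar>x\<bar> powr (- \<alpha>) * exp (b * \<bar>x\<bar> powr (- \<beta>))"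
  have lim: "(?h \<longlongrightarrow> C\<^sub>g) (at 0 within ?S)" and x\<^sub>0: "x\<^sub>0 \<in> {0..1}" and zero: "g x\<^sub>0 = 0" and C: "0 < C\<^sub>g"
    using assms by (auto simp: assumption_A_def)
  have "\<forall>\<^sub>F x in at 0 within ?S. ?h x < C\<^sub>g + 1"
    by (rule order_tendstoD[OF lim]) simp
  then obtain d where d: "0 < d" "\<And>x. x \<in> ?S \<Longrightarrow> x \<noteq> 0 \<Longrightarrow> dist x 0 < d \<Longrightarrow> ?h x < C\<^sub>g + 1"
    unfolding eventually_at by auto
  show ?thesis
  proof (rule that[OF d(1)])
    fix x assume x: "x \<in> {0..1}" "\<bar>x - x\<^sub>0\<bar> < d"
    define u where "u = \<bar>x - x\<^sub>0\<bar>"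
    show "g x \<le> (C\<^sub>g + 1) * (\<bar>x - x\<^sub>0\<bar> powr \<alpha> * exp (- (b * \<bar>x - x\<^sub>0\<bar> powr (- \<beta>))))"
    proof (cases "x = x\<^sub>0")
      \<comment> \<open>The limit is silent at the zero itself; there both sides vanish, because
        \<open>0 powr \<alpha> = 0\<close>.\<close>
      case True
      then show ?thesis
        using zero C by simp
    next
      case False
      then have u: "0 < u"
        by (simp add: u_def)
      have "?h (x - x\<^sub>0) < C\<^sub>g + 1"
        using x False by (intro d(2)) (auto simp: dist_real_def)
      then have "g x * u powr (- \<alpha>) * exp (b * u powr (- \<beta>)) * (u powr \<alpha> * exp (- (b * u powr (- \<beta>)))) \<le>
          (C\<^sub>g + 1) * (u powr \<alpha> * exp (- (b * u powr (- \<beta>))))"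
        unfolding u_def by (intro mult_right_mono) simp_all
      also have "g x * u powr (- \<alpha>) * exp (b * u powr (- \<beta>)) * (u powr \<alpha> * exp (- (b * u powr (- \<beta>)))) =
          g x * (u powr (- \<alpha>) * u powr \<alpha>) * (exp (b * u powr (- \<beta>)) * exp (- (b * u powr (- \<beta>))))"
        by (simp only: mult_ac)
      also have "\<dots> = g x"
        using u by (simp flip: powr_add exp_add)
      finally show ?thesis
        by (simp add: u_def)
    qed
  qed
qed

text \<open>For negative \<alpha> the power blows up at 0, but the exponential still wins.\<close>

lemma tendsto_powr_exp_zero:
  fixes \<alpha> b \<beta> :: real
  assumes "0 < b" "0 < \<beta>"
  shows "((\<lambda>u. u powr \<alpha> * exp (- (b * u powr (- \<beta>)))) \<longlongrightarrow> 0) (at_right 0)"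
  using assms by real_asymp

theorem theorem1:
  fixes \<phi> \<psi> g :: "real \<Rightarrow> real"
    and r :: nat
    and L\<^sub>\<phi> U\<^sub>\<phi> L\<^sub>\<psi> U\<^sub>\<psi> :: int
    and p q :: ennreal
    and s A x\<^sub>0 \<alpha> b \<beta> C\<^sub>g :: real
  defines "s' \<equiv> s_prime s p"
    and "m\<^sub>1 \<equiv> coarsest_level L\<^sub>\<phi> U\<^sub>\<phi> L\<^sub>\<psi> U\<^sub>\<psi>"
  assumes "regular_wavelet_pair r \<phi> \<psi>"
    and "supp \<phi> = {of_int L\<^sub>\<phi>..of_int U\<^sub>\<phi>}" and "supp \<psi> = {of_int L\<^sub>\<psi>..of_int U\<^sub>\<psi>}"
    and "L\<^sub>\<phi> \<le> 0" and "0 \<le> U\<^sub>\<phi>" and "U\<^sub>\<phi> - L\<^sub>\<phi> \<ge> 4"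
    and "probability_density_on_unit g"
    and "assumption_A g x\<^sub>0 \<alpha> b \<beta> C\<^sub>g"
    and "1 \<le> p" and "1 \<le> q"
    and "max (enn2real (1 / p)) (1 / 2) \<le> s" and "s < real r"
    and "A > 0"
  shows "\<exists>C>0. \<forall>\<^sub>F n in sequentially.
    minimax_risk g n (besov_ball \<phi> \<psi> m\<^sub>1 s p q A) \<ge>
      ennreal (C * (if b = 0 \<and> \<alpha> * s < s' then real n powr (- (2 * s / (2 * s + 1)))
                    else if b = 0 then real n powr (- (2 * s' / (2 * s' + \<alpha>)))
                    else ln (real n) powr (- (2 * s' / \<beta>))))"
proof -
  note g = \<open>probability_density_on_unit g\<close> and A = \<open>assumption_A g x\<^sub>0 \<alpha> b \<beta> C\<^sub>g\<close>
  note setting = assms(3-5) g \<open>1 \<le> p\<close> \<open>1 \<le> q\<close>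
  have x\<^sub>0: "x\<^sub>0 \<in> {0..1}" and \<beta>: "0 < \<beta>" and b: "0 \<le> b" "b = 0 \<Longrightarrow> 0 < \<alpha>" and C\<^sub>g: "0 < C\<^sub>g"
    and cont: "continuous_on {0..1} g"
    using A by (auto simp: assumption_A_def)
  \<comment> \<open>The inequality s' \<ge> 1/2 is s \<ge> 1/p rewritten.\<close>
  have s: "1 / 2 \<le> s" and s': "1 / 2 \<le> s'"
    using \<open>max (enn2real (1 / p)) (1 / 2) \<le> s\<close> by (auto simp: s'_def s_prime_def)
  obtain d where d: "0 < d" "\<And>x. x \<in> {0..1} \<Longrightarrow> \<bar>x - x\<^sub>0\<bar> < d \<Longrightarrow>
    g x \<le> (C\<^sub>g + 1) * (\<bar>x - x\<^sub>0\<bar> powr \<alpha> * exp (- (b * \<bar>x - x\<^sub>0\<bar> powr (- \<beta>))))"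
    by (rule assumption_A_upper_bound[OF A]) blast
  obtain \<rho> where \<rho>: "0 < \<rho>" and
    sparse: "\<And>\<Gamma> Y M. filterlim Y at_top sequentially \<Longrightarrow>
      \<forall>\<^sub>F X in at_top. 0 \<le> \<Gamma> X \<and> (\<forall>x\<in>{0..1}. \<bar>x - x\<^sub>0\<bar> \<le> \<rho> / X \<longrightarrow> g x \<le> \<Gamma> X) \<Longrightarrow>
      (\<And>n X. 0 < n \<Longrightarrow> 1 \<le> X \<Longrightarrow> 1 \<le> Y n \<Longrightarrow> Y n \<le> X \<Longrightarrow> real n * X powr (- 2 * s') * \<Gamma> X \<le> M) \<Longrightarrow>
      \<exists>C>0. \<forall>\<^sub>F n in sequentially. ennreal (C * Y n powr (- 2 * s')) \<le>
        minimax_risk g n (besov_ball \<phi> \<psi> m\<^sub>1 s p q A)"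
    unfolding s'_def
    by (rule sparse_lower_bound[OF setting x\<^sub>0 s'[unfolded s'_def] \<open>A > 0\<close>, where m=m\<^sub>1]) blast
  have near: "\<forall>\<^sub>F X in at_top. 0 < X \<and> \<rho> / X < d'" if "0 < d'" for d'
  proof -
    have "((\<lambda>X. \<rho> / X) \<longlongrightarrow> 0) at_top"
      by real_asymp
    then have "\<forall>\<^sub>F X in at_top. \<rho> / X < d'"
      using that by (rule order_tendstoD)
    with eventually_gt_at_top[of 0] show ?thesis
      by eventually_elim simp
  qed
  consider "b = 0" "\<alpha> * s < s'" | "b = 0" "\<not> \<alpha> * s < s'" | "0 < b"
    using b by fastforce
  then show ?thesis
  proof cases
    case 1
    have "bounded (g ` {0..1})"
      using cont by (intro compact_imp_bounded compact_continuous_image) auto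
    then obtain G where G: "\<forall>x\<in>{0..1}. \<bar>g x\<bar> \<le> G"
      unfolding bounded_iff by auto
    then have "g x \<le> max 0 G" if "x \<in> {0..1}" for x
      using bspec[OF G that] by linarith
    then show ?thesis
      using dense_lower_bound[OF setting, of "max 0 G" s A m\<^sub>1] s \<open>A > 0\<close> 1 by simp
  next
    case 2
    then have \<alpha>: "0 < \<alpha>"
      using b by simp
    \<comment> \<open>The solution of n Y powr (-2 s') Y powr (-\<alpha>) = 1, the scale at which
      one wavelet at the zero becomes undetectable.\<close>
    define Y where "Y n = real n powr (1 / (2 * s' + \<alpha>))" for n
    define \<Gamma> where "\<Gamma> X = (C\<^sub>g + 1) * (\<rho> / X) powr \<alpha>" for X
    have "\<exists>C>0. \<forall>\<^sub>F n in sequentially. ennreal (C * Y n powr (- 2 * s')) \<le>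
        minimax_risk g n (besov_ball \<phi> \<psi> m\<^sub>1 s p q A)"
    proof (rule sparse)
      show "filterlim Y at_top sequentially"
        unfolding Y_def using \<alpha> s'
        by (intro filterlim_compose[OF real_powr_at_top filterlim_real_sequentially]) simp
      show "\<forall>\<^sub>F X in at_top. 0 \<le> \<Gamma> X \<and> (\<forall>x\<in>{0..1}. \<bar>x - x\<^sub>0\<bar> \<le> \<rho> / X \<longrightarrow> g x \<le> \<Gamma> X)"
        using near[OF d(1)]
      proof eventually_elim
        case (elim X)
        have "g x \<le> \<Gamma> X" if x: "x \<in> {0..1}" "\<bar>x - x\<^sub>0\<bar> \<le> \<rho> / X" for x
        proof -
          have "g x \<le> (C\<^sub>g + 1) * \<bar>x - x\<^sub>0\<bar> powr \<alpha>"
            using d(2)[OF x(1)] x(2) elim 2 by simp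
          also have "\<dots> \<le> \<Gamma> X"
            unfolding \<Gamma>_def using x \<alpha> C\<^sub>g by (intro mult_left_mono powr_mono2) auto
          finally show ?thesis .
        qed
        then show ?case
          using C\<^sub>g by (simp add: \<Gamma>_def)
      qed
      fix n :: nat and X :: real
      assume n: "0 < n" and X: "1 \<le> X" and Y: "1 \<le> Y n" "Y n \<le> X"
      have "real n = Y n powr (2 * s' + \<alpha>)"
        using n \<alpha> s' by (simp add: Y_def powr_powr)
      also have "\<dots> \<le> X powr (2 * s' + \<alpha>)"
        using Y \<alpha> s' by (intro powr_mono2) auto
      finally have "real n * (X powr (- 2 * s') * X powr (- \<alpha>)) \<le>
          X powr (2 * s' + \<alpha>) * (X powr (- 2 * s') * X powr (- \<alpha>))"
        by (rule mult_right_mono) simp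
      also have "\<dots> = 1"
        using X by (simp flip: powr_add)
      finally have "(C\<^sub>g + 1) * \<rho> powr \<alpha> * (real n * (X powr (- 2 * s') * X powr (- \<alpha>))) \<le> (C\<^sub>g + 1) * \<rho> powr \<alpha> * 1"
        using C\<^sub>g by (intro mult_left_mono) auto
      moreover have "(\<rho> / X) powr \<alpha> = \<rho> powr \<alpha> * X powr (- \<alpha>)"
        using X \<rho> by (simp add: powr_divide powr_minus_divide)
      ultimately show "real n * X powr (- 2 * s') * \<Gamma> X \<le> (C\<^sub>g + 1) * \<rho> powr \<alpha>"
        by (simp add: \<Gamma>_def mult_ac)
    qed
    then show ?thesis
      using 2 by (simp add: Y_def powr_powr)
  next
    case 3
    \<comment> \<open>Half of \<open>b\<close> is given up to absorb \<open>u powr \<alpha>\<close>,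
      which is unbounded near 0 for negative \<alpha>; \<open>\<rho> powr (- \<beta>)\<close>
      converts the size of the window into \<open>X\<close>.\<close>
    define \<kappa> where "\<kappa> = b / 2 * \<rho> powr (- \<beta>)"
    have \<kappa>: "0 < \<kappa>"
      using 3 \<rho> by (simp add: \<kappa>_def)
    \<comment> \<open>Chosen so that \<kappa> Y powr \<beta> = ln n, the scale at which
      \<open>\<Gamma>\<close> has come down to \<open>(C\<^sub>g + 1) / n\<close>.\<close>
    define Y where "Y n = (ln (real n) / \<kappa>) powr (1 / \<beta>)" for n
    define \<Gamma> where "\<Gamma> X = (C\<^sub>g + 1) * exp (- (\<kappa> * X powr \<beta>))" for X
    have "\<forall>\<^sub>F u in at_right 0. u powr \<alpha> * exp (- (b / 2 * u powr (- \<beta>))) < 1"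
      by (rule order_tendstoD[OF tendsto_powr_exp_zero]) (use 3 \<beta> in auto)
    then obtain d' where d': "0 < d'" "\<And>u. 0 < u \<Longrightarrow> u < d' \<Longrightarrow> u powr \<alpha> * exp (- (b / 2 * u powr (- \<beta>))) < 1"
      unfolding eventually_at_right_field by blast
    have "\<exists>C>0. \<forall>\<^sub>F n in sequentially. ennreal (C * Y n powr (- 2 * s')) \<le>
        minimax_risk g n (besov_ball \<phi> \<psi> m\<^sub>1 s p q A)"
    proof (rule sparse)
      show "filterlim Y at_top sequentially"
        unfolding Y_def using \<kappa> \<beta> by real_asymp
      show "\<forall>\<^sub>F X in at_top. 0 \<le> \<Gamma> X \<and> (\<forall>x\<in>{0..1}. \<bar>x - x\<^sub>0\<bar> \<le> \<rho> / X \<longrightarrow> g x \<le> \<Gamma> X)"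
        using near[OF d(1)] near[OF d'(1)]
      proof eventually_elim
        case (elim X)
        have "g x \<le> \<Gamma> X" if x: "x \<in> {0..1}" "\<bar>x - x\<^sub>0\<bar> \<le> \<rho> / X" for x
        proof -
          define u where "u = \<bar>x - x\<^sub>0\<bar>"
          have u: "0 \<le> u" "u \<le> \<rho> / X" "u < d" "u < d'"
            using x elim by (auto simp: u_def)
          have "g x \<le> (C\<^sub>g + 1) * (u powr \<alpha> * exp (- (b * u powr (- \<beta>))))"
            using d(2)[OF x(1)] u by (simp add: u_def)
          also have "\<dots> \<le> \<Gamma> X"
          proof (cases "u = 0")
            case False
            have "(\<rho> / X) powr (- \<beta>) \<le> u powr (- \<beta>)"
              using u False \<beta> by (intro powr_mono2') auto
            moreover have "(\<rho> / X) powr (- \<beta>) = \<rho> powr (- \<beta>) * X powr \<beta>"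
              using \<rho> elim by (simp add: powr_divide powr_minus_divide)
            ultimately have "\<kappa> * X powr \<beta> \<le> b / 2 * u powr (- \<beta>)"
              using 3 by (simp add: \<kappa>_def)
            then have "exp (- (b / 2 * u powr (- \<beta>))) \<le> exp (- (\<kappa> * X powr \<beta>))"
              by simp
            moreover have "u powr \<alpha> * exp (- (b / 2 * u powr (- \<beta>))) \<le> 1"
              using d'(2)[of u] u False by simp
            \<comment> \<open>The exponential is split into two equal halves: one absorbs the power
              of \<open>u\<close>, the other yields \<open>\<Gamma> X\<close>.\<close>
            ultimately have le: "u powr \<alpha> * exp (- (b / 2 * u powr (- \<beta>))) * exp (- (b / 2 * u powr (- \<beta>))) \<le>
                1 * exp (- (\<kappa> * X powr \<beta>))"
              by (intro mult_mono) auto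
            have eq: "u powr \<alpha> * exp (- (b / 2 * u powr (- \<beta>))) * exp (- (b / 2 * u powr (- \<beta>))) =
                u powr \<alpha> * exp (- (b * u powr (- \<beta>)))"
              by (simp add: mult.assoc flip: exp_add)
            show ?thesis
              unfolding \<Gamma>_def using C\<^sub>g le[unfolded eq mult_1_left] by (intro mult_left_mono) auto
          qed (use C\<^sub>g in \<open>simp add: \<Gamma>_def\<close>)
          finally show ?thesis .
        qed
        then show ?case
          using C\<^sub>g by (simp add: \<Gamma>_def)
      qed
      fix n :: nat and X :: real
      assume n: "0 < n" and X: "1 \<le> X" and Y: "1 \<le> Y n" "Y n \<le> X"
      \<comment> \<open>Y n \<ge> 1 excludes n = 1, where \<open>Y n\<close> would be 0 because
        \<open>0 powr (1 / \<beta>) = 0\<close>.\<close>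
      have "0 < ln (real n)"
        using Y(1) n \<kappa> by (cases "n = 1") (auto simp: Y_def)
      then have "ln (real n) / \<kappa> = Y n powr \<beta>"
        using \<kappa> \<beta> by (simp add: Y_def powr_powr)
      also have "\<dots> \<le> X powr \<beta>"
        using Y \<beta> by (intro powr_mono2) auto
      finally have "ln (real n) \<le> \<kappa> * X powr \<beta>"
        using \<kappa> by (simp add: field_simps)
      then have "real n * exp (- (\<kappa> * X powr \<beta>)) \<le> real n * exp (- ln (real n))"
        by (intro mult_left_mono) auto
      also have "\<dots> = 1"
        using n by (simp add: exp_minus)
      finally have 1: "real n * exp (- (\<kappa> * X powr \<beta>)) \<le> 1" .
      \<comment> \<open>The exponential alone compensates \<open>n\<close>; the power of
        \<open>X\<close> is simply bounded by 1.\<close>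
      have "X powr (- 2 * s') \<le> X powr 0"
        using X s' by (intro powr_mono) auto
      then have "(real n * exp (- (\<kappa> * X powr \<beta>))) * X powr (- 2 * s') \<le> 1 * 1"
        using X 1 by (intro mult_mono) auto
      then have "(C\<^sub>g + 1) * ((real n * exp (- (\<kappa> * X powr \<beta>))) * X powr (- 2 * s')) \<le> (C\<^sub>g + 1) * (1 * 1)"
        using C\<^sub>g by (intro mult_left_mono) auto
      then show "real n * X powr (- 2 * s') * \<Gamma> X \<le> C\<^sub>g + 1"
        by (simp add: \<Gamma>_def mult_ac)
    qed
    then obtain C where C: "0 < C" "\<forall>\<^sub>F n in sequentially. ennreal (C * Y n powr (- 2 * s')) \<le>
        minimax_risk g n (besov_ball \<phi> \<psi> m\<^sub>1 s p q A)"
      by blast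
    \<comment> \<open>The factor \<kappa> hidden in \<open>Y n\<close> is moved into the
      constant.\<close>
    have eq: "ennreal (C * \<kappa> powr (2 * s' / \<beta>) * ln (real n) powr (- (2 * s' / \<beta>))) = ennreal (C * Y n powr (- 2 * s'))"
      if "0 < n" for n
    proof -
      have "0 \<le> ln (real n)"
        using that by simp
      then show ?thesis
        using \<kappa> by (simp add: Y_def powr_powr powr_divide powr_minus_divide)
    qed
    have "\<forall>\<^sub>F n in sequentially. ennreal (C * \<kappa> powr (2 * s' / \<beta>) * ln (real n) powr (- (2 * s' / \<beta>))) \<le>
        minimax_risk g n (besov_ball \<phi> \<psi> m\<^sub>1 s p q A)"
      using C(2) eventually_gt_at_top[of 0] by eventually_elim (simp only: eq)
    then show ?thesis
      using 3 C(1) \<kappa> by (intro exI[of _ "C * \<kappa> powr (2 * s' / \<beta>)"]) simp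
  qed
qed

end
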